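(* Let $\mathbb{G}$ be a compact quantum group of Kac type whose irreducible corepresentations (up to equivalence) are indexed by $s\in\mathbb{N}=\{0,1,2,\dots\}$, let $V_s$ be the linear span of the coefficients of the $s$-th irreducible corepresentation $u^{(s)}$, and let $(T_t)_{t\ge 0}$ be a Markov semigroup on $\mathbb{G}$ with generator $T_L:\mathrm{Pol}(\mathbb{G})\to\mathrm{Pol}(\mathbb{G})$. Assume: (1) for every $s\in\mathbb{N}$ there is a real number $\lambda_s$ with $T_L x=\lambda_s x$ for all $x\in V_s$; (2) there is $\alpha>0$ such that $\lambda_s\le-\alpha s$ for all $s\in\mathbb{N}$; (3) there are constants $\beta,\gamma\ge 0$, independent of $s$, such that $\|x\|_\infty\le(\beta s+\gamma)\|x\|_2$ for all $s\in\mathbb{N}$ and $x\in V_s$. Then $T_t$ is ultracontractive: for all $t>0$ and all $x\in L^2(\mathbb{G})$, $$\|T_tx\|_\infty\le\sqrt{f(t)}\,\|x\|_2,$$ where $$f(t)=\frac{\beta^2e^{-2\alpha t}(1+e^{-2\alpha t})+2\beta\gamma e^{-2\alpha t}(1-e^{-2\alpha t})+\gamma^2(1-e^{-2\alpha t})^2}{(1-e^{-2\alpha t})^3}.$$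
   Context: For a compact quantum group $\mathbb{G}$ with comultiplication $\Delta$, $\mathrm{Pol}(\mathbb{G})$ is the $*$-algebra spanned by the coefficients of the irreducible (unitary, finite-dimensional) corepresentations, and $h$ is the Haar state. Kac type means that $h$ is a trace. $C_r(\mathbb{G})$ is the norm closure of $\mathrm{Pol}(\mathbb{G})$ in the GNS representation of $h$, and $L^\infty(\mathbb{G})=C_r(\mathbb{G})''$, on which $h$ is a faithful normal tracial state. $\|\cdot\|_\infty$ is the operator norm, $\|x\|_p=[h((x^*x)^{p/2})]^{1/p}$ for $1\le p<\infty$, and $L^p(\mathbb{G})$ is the completion of $L^\infty(\mathbb{G})$ for $\|\cdot\|_p$. A Markov semigroup on $\mathbb{G}$ is here the semigroup $T_t=(\mathrm{id}\otimes\phi_t)\circ\Delta$ of unital completely positive maps associated with a L\'evy process on $\mathbb{G}$: $(\phi_t)_{t\ge0}$ is a convolution semigroup of states on $\mathrm{Pol}(\mathbb{G})$, pointwise continuous with $\phi_0$ equal to the counit. With $L=\frac{d\phi_t}{dt}|_{t=0}$, its generator on $\mathrm{Pol}(\mathbb{G})$ is $T_L=(\mathrm{id}\otimes L)\circ\Delta=\frac{dT_t}{dt}|_{t=0}$, and $T_t=\exp(tT_L)$ on $\mathrm{Pol}(\mathbb{G})$. Under assumption (1), $T_t$ is self-adjoint on $L^2(\mathbb{G})$ and extends to $L^\infty(\mathbb{G})$ and contractively to every $L^p(\mathbb{G})$. Ultracontractive means: $T_t$ is bounded from $L^2(\mathbb{G})$ to $L^\infty(\mathbb{G})$ for every $t>0$.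 *)

theory Defs
  imports
    Complex_Main
    "HOL-Analysis.Elementary_Normed_Spaces"
    "HOL-Analysis.Operator_Norm"
    "Jordan_Normal_Form.Matrix"
begin

subsection \<open>Complex normed spaces, unital C*-algebras, complex Hilbert spaces\<close>

class complex_vector = real_vector +
  fixes scaleC :: "complex \<Rightarrow> 'a \<Rightarrow> 'a"  (infixr \<open>*\<^sub>C\<close> 75)
  assumes scaleC_add_right: "a *\<^sub>C (x + y) = a *\<^sub>C x + a *\<^sub>C y"
    and scaleC_add_left: "(a + b) *\<^sub>C x = a *\<^sub>C x + b *\<^sub>C x"
    and scaleC_scaleC: "a *\<^sub>C b *\<^sub>C x = (a * b) *\<^sub>C x"
    and scaleC_one: "1 *\<^sub>C x = x"
    and scaleR_scaleC: "r *\<^sub>R x = complex_of_real r *\<^sub>C x"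

class complex_normed_vector = complex_vector + real_normed_vector +
  assumes norm_scaleC: "norm (a *\<^sub>C x) = cmod a * norm x"

class cstar_algebra = complex_normed_vector + real_normed_algebra_1 + banach +
  fixes star :: "'a \<Rightarrow> 'a"
  assumes mult_scaleC_left: "(a *\<^sub>C x) * y = a *\<^sub>C (x * y)"
    and mult_scaleC_right: "x * (a *\<^sub>C y) = a *\<^sub>C (x * y)"
    and star_star: "star (star x) = x"
    and star_add: "star (x + y) = star x + star y"
    and star_scaleC: "star (a *\<^sub>C x) = cnj a *\<^sub>C star x"
    and star_mult: "star (x * y) = star y * star x"
    and cstar_identity: "norm (star x * x) = (norm x)\<^sup>2"

text \<open>The inner product is conjugate linear in the first and linear in the second argument.\<close>

class complex_hilbert = complex_normed_vector + banach +
  fixes cinner :: "'a \<Rightarrow> 'a \<Rightarrow> complex"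
  assumes cinner_commute: "cinner x y = cnj (cinner y x)"
    and cinner_add_right: "cinner x (y + z) = cinner x y + cinner x z"
    and cinner_scaleC_right: "cinner x (a *\<^sub>C y) = a * cinner x y"
    and cinner_norm: "cinner x x = complex_of_real ((norm x)\<^sup>2)"

instantiation complex :: complex_normed_vector
begin
definition scaleC_complex_def: "(a::complex) *\<^sub>C (x::complex) = a * x"
instance
  by standard (auto simp: scaleC_complex_def algebra_simps norm_mult scaleR_conv_of_real)
end

global_interpretation complex_vector: vector_space "scaleC :: complex \<Rightarrow> 'a \<Rightarrow> 'a::complex_vector"
  defines cspan = complex_vector.span
  by standard (simp_all add: scaleC_add_right scaleC_add_left scaleC_scaleC scaleC_one)

definition clinear_on :: "'a::complex_vector set \<Rightarrow> ('a \<Rightarrow> 'b::complex_vector) \<Rightarrow> bool" where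
  "clinear_on S f \<longleftrightarrow>
     (\<forall>x\<in>S. \<forall>y\<in>S. f (x + y) = f x + f y) \<and> (\<forall>c. \<forall>x\<in>S. f (c *\<^sub>C x) = c *\<^sub>C f x)"

definition cbilinear :: "('a::complex_vector \<Rightarrow> 'b::complex_vector \<Rightarrow> 'c::complex_vector) \<Rightarrow> bool" where
  "cbilinear B \<longleftrightarrow> (\<forall>b. clinear_on UNIV (\<lambda>a. B a b)) \<and> (\<forall>a. clinear_on UNIV (B a))"

definition bounded_clinear :: "('a::complex_normed_vector \<Rightarrow> 'b::complex_normed_vector) \<Rightarrow> bool" where
  "bounded_clinear f \<longleftrightarrow> bounded_linear f \<and> (\<forall>c x. f (c *\<^sub>C x) = c *\<^sub>C f x)"

definition state_on :: "'a::cstar_algebra set \<Rightarrow> ('a \<Rightarrow> complex) \<Rightarrow> bool" where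
  "state_on S \<phi> \<longleftrightarrow> clinear_on S \<phi> \<and> \<phi> 1 = 1 \<and>
     (\<forall>x\<in>S. Im (\<phi> (star x * x)) = 0 \<and> Re (\<phi> (star x * x)) \<ge> 0)"


subsection \<open>Minimal tensor products\<close>

definition cstar_norm_on :: "'a::cstar_algebra set \<Rightarrow> ('a \<Rightarrow> real) \<Rightarrow> bool" where
  "cstar_norm_on S p \<longleftrightarrow>
     (\<forall>z\<in>S. p z \<ge> 0 \<and> (p z = 0 \<longleftrightarrow> z = 0)) \<and>
     (\<forall>z\<in>S. \<forall>w\<in>S. p (z + w) \<le> p z + p w) \<and>
     (\<forall>c. \<forall>z\<in>S. p (c *\<^sub>C z) = cmod c * p z) \<and>
     (\<forall>z\<in>S. \<forall>w\<in>S. p (z * w) \<le> p z * p w) \<and>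
     (\<forall>z\<in>S. p (star z * z) = (p z)\<^sup>2)"

definition alg_tensor :: "('a \<Rightarrow> 'b \<Rightarrow> 'c::complex_vector) \<Rightarrow> 'c set" where
  "alg_tensor T = cspan (range (\<lambda>(a, b). T a b))"

text \<open>
  A C*-algebra \<open>'c\<close> with a map \<open>T a b = a \<otimes> b\<close> is the minimal tensor product of \<open>'a\<close> and \<open>'b\<close>
  if the linear span of the elementary tensors is the algebraic tensor product (universal
  property), carries the tensor product *-algebra structure, is dense, and the norm of \<open>'c\<close>
  restricts to the least C*-norm on it (by Takesaki's theorem, the spatial norm).
\<close>

definition minimal_tensor_product ::
    "('a::cstar_algebra \<Rightarrow> 'b::cstar_algebra \<Rightarrow> 'c::cstar_algebra) \<Rightarrow> bool" where
  "minimal_tensor_product T \<longleftrightarrow>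
     cbilinear T \<and>
     (\<forall>B :: 'a \<Rightarrow> 'b \<Rightarrow> complex. cbilinear B \<longrightarrow>
        (\<exists>F. clinear_on (alg_tensor T) F \<and> (\<forall>a b. F (T a b) = B a b))) \<and>
     (\<forall>a b c d. T a b * T c d = T (a * c) (b * d)) \<and>
     (\<forall>a b. star (T a b) = T (star a) (star b)) \<and>
     closure (alg_tensor T) = UNIV \<and>
     (\<forall>p. cstar_norm_on (alg_tensor T) p \<longrightarrow> (\<forall>z\<in>alg_tensor T. norm z \<le> p z))"

definition tensor_extension ::
    "('a \<Rightarrow> 'b \<Rightarrow> 'c::complex_normed_vector) \<Rightarrow> ('a \<Rightarrow> 'b \<Rightarrow> 'd::complex_normed_vector) \<Rightarrow> ('c \<Rightarrow> 'd) \<Rightarrow> bool"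
  where
  "tensor_extension T B F \<longleftrightarrow> bounded_clinear F \<and> (\<forall>a b. F (T a b) = B a b)"


subsection \<open>Compact quantum groups (Woronowicz)\<close>

text \<open>
  The type \<open>'a\<close> is the C*-algebra \<open>A\<close>, the type \<open>'b\<close> is \<open>A \<otimes> A\<close>, and the type \<open>'c\<close> is
  \<open>A \<otimes> A \<otimes> A\<close>, which is regarded both as \<open>A \<otimes> (A \<otimes> A)\<close> (via \<open>tens_left\<close>) and as
  \<open>(A \<otimes> A) \<otimes> A\<close> (via \<open>tens_right\<close>).
\<close>

record ('a, 'b, 'c) quantum_group =
  tens :: "'a \<Rightarrow> 'a \<Rightarrow> 'b"
  tens_left :: "'a \<Rightarrow> 'b \<Rightarrow> 'c"
  tens_right :: "'b \<Rightarrow> 'a \<Rightarrow> 'c"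
  comult :: "'a \<Rightarrow> 'b"

text \<open>
  In the coassociativity condition, \<open>F\<close> is \<open>\<Delta> \<otimes> id\<close> and \<open>K\<close> is \<open>id \<otimes> \<Delta>\<close>. The last two
  conjuncts are the density (cancellation) conditions.
\<close>

definition compact_quantum_group ::
    "('a::cstar_algebra, 'b::cstar_algebra, 'c::cstar_algebra) quantum_group \<Rightarrow> bool" where
  "compact_quantum_group G \<longleftrightarrow>
     minimal_tensor_product (tens G) \<and>
     minimal_tensor_product (tens_left G) \<and>
     minimal_tensor_product (tens_right G) \<and>
     (\<forall>x y z. tens_left G x (tens G y z) = tens_right G (tens G x y) z) \<and>
     clinear_on UNIV (comult G) \<and>
     (\<forall>x y. comult G (x * y) = comult G x * comult G y) \<and>
     (\<forall>x. comult G (star x) = star (comult G x)) \<and>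
     comult G 1 = 1 \<and>
     (\<exists>F K. tensor_extension (tens G) (\<lambda>x y. tens_right G (comult G x) y) F \<and>
            tensor_extension (tens G) (\<lambda>x y. tens_left G x (comult G y)) K \<and>
            (\<forall>x. F (comult G x) = K (comult G x))) \<and>
     closure (cspan {comult G x * tens G 1 y |x y. True}) = UNIV \<and>
     closure (cspan {comult G x * tens G y 1 |x y. True}) = UNIV"

text \<open>\<open>E\<close> is the slice map \<open>id \<otimes> h\<close> and \<open>K\<close> is the slice map \<open>h \<otimes> id\<close>.\<close>

definition haar_state ::
    "('a::cstar_algebra, 'b::cstar_algebra, 'c::cstar_algebra) quantum_group \<Rightarrow> ('a \<Rightarrow> complex) \<Rightarrow> bool"
  where
  "haar_state G h \<longleftrightarrow> state_on UNIV h \<and>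
     (\<exists>E K. tensor_extension (tens G) (\<lambda>x y. h y *\<^sub>C x) E \<and>
            tensor_extension (tens G) (\<lambda>x y. h x *\<^sub>C y) K \<and>
            (\<forall>x. E (comult G x) = h x *\<^sub>C 1 \<and> K (comult G x) = h x *\<^sub>C 1))"

definition tracial :: "('a::cstar_algebra \<Rightarrow> complex) \<Rightarrow> bool" where
  "tracial h \<longleftrightarrow> (\<forall>x y. h (x * y) = h (y * x))"


subsection \<open>Irreducible unitary corepresentations and the algebra of coefficients\<close>

definition star_mat :: "'a::cstar_algebra mat \<Rightarrow> 'a mat" where
  "star_mat u = map_mat star (transpose_mat u)"

definition unitary_corep ::
    "('a::cstar_algebra, 'b::cstar_algebra, 'c::cstar_algebra) quantum_group \<Rightarrow> 'a mat \<Rightarrow> bool" where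
  "unitary_corep G u \<longleftrightarrow> square_mat u \<and>
     (\<forall>i<dim_row u. \<forall>j<dim_row u.
        comult G (u $$ (i, j)) = (\<Sum>k<dim_row u. tens G (u $$ (i, k)) (u $$ (k, j)))) \<and>
     star_mat u * u = 1\<^sub>m (dim_row u) \<and> u * star_mat u = 1\<^sub>m (dim_row u)"

definition intertwiner :: "'a::cstar_algebra mat \<Rightarrow> 'a mat \<Rightarrow> complex mat \<Rightarrow> bool" where
  "intertwiner u v X \<longleftrightarrow> X \<in> carrier_mat (dim_row v) (dim_row u) \<and>
     map_mat (\<lambda>c. c *\<^sub>C 1) X * u = v * map_mat (\<lambda>c. c *\<^sub>C 1) X"

definition equivalent_corep :: "'a::cstar_algebra mat \<Rightarrow> 'a mat \<Rightarrow> bool" where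
  "equivalent_corep u v \<longleftrightarrow> (\<exists>X. intertwiner u v X \<and> invertible_mat X)"

definition irreducible_corep ::
    "('a::cstar_algebra, 'b::cstar_algebra, 'c::cstar_algebra) quantum_group \<Rightarrow> 'a mat \<Rightarrow> bool" where
  "irreducible_corep G u \<longleftrightarrow> unitary_corep G u \<and> dim_row u > 0 \<and>
     (\<forall>X. intertwiner u u X \<longrightarrow> (\<exists>c. X = c \<cdot>\<^sub>m 1\<^sub>m (dim_row u)))"

definition irrep_enumeration ::
    "('a::cstar_algebra, 'b::cstar_algebra, 'c::cstar_algebra) quantum_group \<Rightarrow> (nat \<Rightarrow> 'a mat) \<Rightarrow> bool"
  where
  "irrep_enumeration G u \<longleftrightarrow>
     (\<forall>s. irreducible_corep G (u s)) \<and>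
     (\<forall>s s'. equivalent_corep (u s) (u s') \<longrightarrow> s = s') \<and>
     (\<forall>v. irreducible_corep G v \<longrightarrow> (\<exists>s. equivalent_corep v (u s)))"

definition coeff_space :: "'a::cstar_algebra mat \<Rightarrow> 'a set" where
  "coeff_space u = cspan {u $$ (i, j) |i j. i < dim_row u \<and> j < dim_row u}"

definition Pol ::
    "('a::cstar_algebra, 'b::cstar_algebra, 'c::cstar_algebra) quantum_group \<Rightarrow> 'a set" where
  "Pol G = cspan (\<Union>v\<in>{v. irreducible_corep G v}. coeff_space v)"


subsection \<open>Convolution semigroups of states and their Markov semigroups\<close>

text \<open>
  Functionals on \<open>Pol G\<close> need not be bounded, so their slice maps only make sense on the algebraic
  tensor product of \<open>Pol G\<close> with itself, which contains \<open>comult G x\<close> for all \<open>x \<in> Pol G\<close>. For \<open>B\<close>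
  bilinear on \<open>Pol G\<close>, \<open>pol_tensor_eval G B\<close> maps a tensor, a sum of elements \<open>a i \<otimes> b i\<close>, to the
  sum of the elements \<open>B (a i) (b i)\<close>.
\<close>

definition pol_tensor_eval ::
    "('a::cstar_algebra, 'b::cstar_algebra, 'c::cstar_algebra) quantum_group
      \<Rightarrow> ('a \<Rightarrow> 'a \<Rightarrow> 'v::comm_monoid_add) \<Rightarrow> 'b \<Rightarrow> 'v" where
  "pol_tensor_eval G B z = (THE w. \<exists>n a b. (\<forall>i<n. a i \<in> Pol G \<and> b i \<in> Pol G) \<and>
     z = (\<Sum>i<(n::nat). tens G (a i) (b i)) \<and> w = (\<Sum>i<n. B (a i) (b i)))"

text \<open>\<open>(\<phi> \<otimes> \<psi>) \<circ> \<Delta>\<close>, \<open>(id \<otimes> \<phi>) \<circ> \<Delta>\<close> and \<open>(\<phi> \<otimes> id) \<circ> \<Delta>\<close> on \<open>Pol G\<close>:\<close>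

definition convolution ::
    "('a::cstar_algebra, 'b::cstar_algebra, 'c::cstar_algebra) quantum_group
      \<Rightarrow> ('a \<Rightarrow> complex) \<Rightarrow> ('a \<Rightarrow> complex) \<Rightarrow> 'a \<Rightarrow> complex" where
  "convolution G \<phi> \<psi> x = pol_tensor_eval G (\<lambda>a b. \<phi> a * \<psi> b) (comult G x)"

definition id_tensor ::
    "('a::cstar_algebra, 'b::cstar_algebra, 'c::cstar_algebra) quantum_group
      \<Rightarrow> ('a \<Rightarrow> complex) \<Rightarrow> 'a \<Rightarrow> 'a" where
  "id_tensor G \<phi> x = pol_tensor_eval G (\<lambda>a b. \<phi> b *\<^sub>C a) (comult G x)"

definition tensor_id ::
    "('a::cstar_algebra, 'b::cstar_algebra, 'c::cstar_algebra) quantum_group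
      \<Rightarrow> ('a \<Rightarrow> complex) \<Rightarrow> 'a \<Rightarrow> 'a" where
  "tensor_id G \<phi> x = pol_tensor_eval G (\<lambda>a b. \<phi> a *\<^sub>C b) (comult G x)"

definition counit ::
    "('a::cstar_algebra, 'b::cstar_algebra, 'c::cstar_algebra) quantum_group
      \<Rightarrow> ('a \<Rightarrow> complex) \<Rightarrow> bool" where
  "counit G \<epsilon> \<longleftrightarrow> clinear_on (Pol G) \<epsilon> \<and>
     (\<forall>x\<in>Pol G. id_tensor G \<epsilon> x = x \<and> tensor_id G \<epsilon> x = x)"

definition convolution_semigroup ::
    "('a::cstar_algebra, 'b::cstar_algebra, 'c::cstar_algebra) quantum_group
      \<Rightarrow> (real \<Rightarrow> 'a \<Rightarrow> complex) \<Rightarrow> bool" where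
  "convolution_semigroup G \<phi> \<longleftrightarrow>
     (\<forall>t\<ge>0. state_on (Pol G) (\<phi> t)) \<and>
     (\<forall>s\<ge>0. \<forall>t\<ge>0. \<forall>x\<in>Pol G. \<phi> (s + t) x = convolution G (\<phi> s) (\<phi> t) x) \<and>
     (\<forall>x\<in>Pol G. continuous_on {0..} (\<lambda>t. \<phi> t x)) \<and>
     counit G (\<phi> 0)"

definition generating_functional ::
    "('a::cstar_algebra, 'b::cstar_algebra, 'c::cstar_algebra) quantum_group
      \<Rightarrow> (real \<Rightarrow> 'a \<Rightarrow> complex) \<Rightarrow> ('a \<Rightarrow> complex) \<Rightarrow> bool" where
  "generating_functional G \<phi> L \<longleftrightarrow>
     (\<forall>x\<in>Pol G. ((\<lambda>t. \<phi> t x) has_vector_derivative L x) (at 0 within {0..}))"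


subsection \<open>\<open>L\<^sup>2\<close>, the reduced C*-algebra and \<open>L\<^sup>\<infinity>\<close>\<close>

text \<open>
  The type \<open>'h\<close> is the GNS Hilbert space of the restriction of \<open>h\<close> to \<open>P\<close>; it is
  \<open>L\<^sup>2\<close> for \<open>P = Pol G\<close>. The vector \<open>\<Lambda> x\<close> is the class of \<open>x\<close>, and \<open>\<pi> x\<close> is left
  multiplication by \<open>x\<close>. An operator \<open>y\<close> in \<open>L\<^sup>\<infinity>\<close> is identified with the vector \<open>y (\<Lambda> 1)\<close>
  of \<open>L\<^sup>2\<close>.
\<close>

definition gns_construction ::
    "'a::cstar_algebra set \<Rightarrow> ('a \<Rightarrow> complex) \<Rightarrow> ('a \<Rightarrow> 'h::complex_hilbert) \<Rightarrow> ('a \<Rightarrow> 'h \<Rightarrow> 'h) \<Rightarrow> bool"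
  where
  "gns_construction P h \<Lambda> \<pi> \<longleftrightarrow>
     clinear_on P \<Lambda> \<and>
     (\<forall>x\<in>P. \<forall>y\<in>P. cinner (\<Lambda> x) (\<Lambda> y) = h (star x * y)) \<and>
     closure (\<Lambda> ` P) = UNIV \<and>
     (\<forall>x\<in>P. bounded_clinear (\<pi> x) \<and> (\<forall>y\<in>P. \<pi> x (\<Lambda> y) = \<Lambda> (x * y)))"

definition L2_norm :: "('a::cstar_algebra \<Rightarrow> complex) \<Rightarrow> 'a \<Rightarrow> real" where
  "L2_norm h x = sqrt (Re (h (star x * x)))"

definition reduced_algebra ::
    "('a::cstar_algebra, 'b::cstar_algebra, 'c::cstar_algebra) quantum_group
      \<Rightarrow> ('a \<Rightarrow> 'h::complex_hilbert \<Rightarrow> 'h) \<Rightarrow> ('h \<Rightarrow> 'h) set" where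
  "reduced_algebra G \<pi> = {S. bounded_clinear S \<and>
     (\<forall>\<epsilon>>0. \<exists>x\<in>Pol G. onorm (\<lambda>\<xi>. S \<xi> - \<pi> x \<xi>) < \<epsilon>)}"

definition commutant :: "('h::complex_hilbert \<Rightarrow> 'h) set \<Rightarrow> ('h \<Rightarrow> 'h) set" where
  "commutant M = {S. bounded_clinear S \<and> (\<forall>R\<in>M. S \<circ> R = R \<circ> S)}"

definition Linf ::
    "('a::cstar_algebra, 'b::cstar_algebra, 'c::cstar_algebra) quantum_group
      \<Rightarrow> ('a \<Rightarrow> 'h::complex_hilbert \<Rightarrow> 'h) \<Rightarrow> ('h \<Rightarrow> 'h) set" where
  "Linf G \<pi> = commutant (commutant (reduced_algebra G \<pi>))"

text \<open>The vector \<open>\<eta>\<close> of \<open>L\<^sup>2\<close> lies in \<open>L\<^sup>\<infinity>\<close> and its operator norm is at most \<open>C\<close>.\<close>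

definition Linf_norm_le ::
    "('a::cstar_algebra, 'b::cstar_algebra, 'c::cstar_algebra) quantum_group
      \<Rightarrow> ('a \<Rightarrow> 'h::complex_hilbert) \<Rightarrow> ('a \<Rightarrow> 'h \<Rightarrow> 'h) \<Rightarrow> 'h \<Rightarrow> real \<Rightarrow> bool" where
  "Linf_norm_le G \<Lambda> \<pi> \<eta> C \<longleftrightarrow> (\<exists>y\<in>Linf G \<pi>. y (\<Lambda> 1) = \<eta> \<and> onorm y \<le> C)"

definition L2_extension ::
    "('a::cstar_algebra, 'b::cstar_algebra, 'c::cstar_algebra) quantum_group
      \<Rightarrow> ('a \<Rightarrow> 'h::complex_hilbert) \<Rightarrow> ('a \<Rightarrow> 'a) \<Rightarrow> 'h \<Rightarrow> 'h" where
  "L2_extension G \<Lambda> T = (THE S. bounded_clinear S \<and> (\<forall>x\<in>Pol G. S (\<Lambda> x) = \<Lambda> (T x)))"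

definition ultracontractive ::
    "('a::cstar_algebra, 'b::cstar_algebra, 'c::cstar_algebra) quantum_group
      \<Rightarrow> ('a \<Rightarrow> 'h::complex_hilbert) \<Rightarrow> ('a \<Rightarrow> 'h \<Rightarrow> 'h) \<Rightarrow> (real \<Rightarrow> 'a \<Rightarrow> 'a) \<Rightarrow> bool" where
  "ultracontractive G \<Lambda> \<pi> T \<longleftrightarrow>
     (\<forall>t>0. \<exists>C. \<forall>\<xi>. Linf_norm_le G \<Lambda> \<pi> (L2_extension G \<Lambda> (T t) \<xi>) (C * norm \<xi>))"

end

theory Submission
  imports
    Defs
    "HOL-Analysis.Bounded_Linear_Function"
    "HOL-Analysis.Derivative"
begin

text \<open>
  On the coefficients of \<open>u s\<close> the convolution semigroup is a semigroup of matrices whose derivative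
  at \<open>0\<close> is \<open>lam s\<close> times the identity, so \<open>T t\<close> acts on the coefficient space as
  \<open>exp (lam s * t)\<close>. By Schur's lemma and traciality of the Haar state, the coefficients of all
  \<open>u s\<close>, suitably scaled, are orthonormal in \<open>L\<^sup>2\<close>; write \<open>\<xi>\<^sub>s\<close> for the corresponding components of
  \<open>\<xi>\<close>. Then the operators \<open>exp (lam s * t) *\<^sub>R \<pi> \<xi>\<^sub>s\<close> form a series which converges in operator norm:
  by the Cauchy-Schwarz and Bessel inequalities the sum of its norms is at most
  \<open>norm \<xi>\<close> times the square root of the sum of the numbers
  \<open>exp (- 2 * \<alpha> * t * s) * (\<beta> * s + \<gamma>)\<^sup>2\<close>, which is \<open>f t\<close>.
  Working with these components avoids any appeal to the linearity of \<open>\<pi>\<close> or to \<open>Pol G\<close> being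
  closed under multiplication.
\<close>

section \<open>Complex-linear maps on subspaces: sums, extension, separation of points\<close>

lemma clinear_on_scaleC: "clinear_on S f \<Longrightarrow> x \<in> S \<Longrightarrow> f (c *\<^sub>C x) = c *\<^sub>C f x"
  by (simp add: clinear_on_def)

lemma clinear_on_add: "clinear_on S f \<Longrightarrow> x \<in> S \<Longrightarrow> y \<in> S \<Longrightarrow> f (x + y) = f x + f y"
  by (simp add: clinear_on_def)

lemma clinear_on_zero: "clinear_on S f \<Longrightarrow> 0 \<in> S \<Longrightarrow> f 0 = 0"
  using clinear_on_scaleC[of S f 0 0] by simp

lemma clinear_on_sum:
  assumes f: "clinear_on S f" and S: "complex_vector.subspace S" and x: "\<And>i. i \<in> I \<Longrightarrow> x i \<in> S"
  shows "f (\<Sum>i\<in>I. x i) = (\<Sum>i\<in>I. f (x i))"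
  using x
proof (induction I rule: infinite_finite_induct)
  case (insert i I)
  then show ?case
    using f complex_vector.subspace_sum[OF S, of I x] by (simp add: clinear_on_add)
qed (use f S in \<open>auto simp: clinear_on_zero complex_vector.subspace_0\<close>)

lemma clinear_on_UNIV_iff: "clinear_on UNIV f \<longleftrightarrow> Vector_Spaces.linear (*\<^sub>C) (*\<^sub>C) f"
  by (auto simp: clinear_on_def Vector_Spaces.linear_iff vector_space_pair_def complex_vector.vector_space_axioms)

lemma clinear_on_eq_on_span:
  assumes f: "clinear_on V f" and g: "clinear_on V g" and B: "B \<subseteq> V" and V: "complex_vector.subspace V"
    and eq: "\<And>x. x \<in> B \<Longrightarrow> f x = g x" and x: "x \<in> cspan B"
  shows "f x = g x"
proof -
  \<comment> \<open>Membership in \<open>V\<close> is carried through the induction because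
    \<open>f\<close> and \<open>g\<close> are linear only on \<open>V\<close>.\<close>
  have "x \<in> V \<and> f x = g x"
    using x
  proof (induction rule: complex_vector.span_induct_alt)
    case base
    then show ?case
      using V f g by (auto simp: clinear_on_zero complex_vector.subspace_0)
  next
    case (step c x y)
    moreover from step B have "x \<in> V" by auto
    ultimately show ?case
      using V f g eq complex_vector.subspace_add[OF V] complex_vector.subspace_scale[OF V]
      by (auto simp: clinear_on_add clinear_on_scaleC)
  qed
  then show ?thesis ..
qed

text \<open>Values on a Hamel basis of \<open>V\<close> extend to the whole space. Functionals such
  as \<open>\<phi> t\<close> are linear only on \<open>Pol G\<close>, whereas the universal property
  of the tensor product speaks of maps that are bilinear on the whole algebra; this lemma bridges
  the two.\<close>

lemma clinear_on_extend:
  fixes f :: "'a::complex_vector \<Rightarrow> 'b::complex_vector"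
  assumes f: "clinear_on V f" and V: "complex_vector.subspace V"
  obtains g where "clinear_on UNIV g" "\<And>x. x \<in> V \<Longrightarrow> g x = f x"
proof -
  interpret vector_space_pair "(*\<^sub>C) :: complex \<Rightarrow> 'a \<Rightarrow> 'a" "(*\<^sub>C) :: complex \<Rightarrow> 'b \<Rightarrow> 'b" ..
  obtain B where B: "B \<subseteq> V" "complex_vector.independent B" "V \<subseteq> cspan B"
    using complex_vector.basis_exists by metis
  obtain g where g: "Vector_Spaces.linear (*\<^sub>C) (*\<^sub>C) g" "\<forall>x\<in>B. g x = f x"
    using linear_independent_extend[OF B(2)] by metis
  show thesis
  proof
    show "clinear_on UNIV g" using g(1) by (simp add: clinear_on_UNIV_iff)
    then show "g x = f x" if "x \<in> V" for x
      using clinear_on_eq_on_span[of V g f B x] f B V g(2) that by (auto simp: clinear_on_def)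
  qed
qed

text \<open>If \<open>x - y\<close> is nonzero, its singleton is independent, so some functional
  takes the value 1 there. This reduces vector-valued identities to scalar ones, as the universal
  property in \<open>minimal_tensor_product\<close> concerns complex-valued bilinear maps.\<close>

lemma clinear_separating:
  fixes x :: "'a::complex_vector"
  assumes "\<And>g :: 'a \<Rightarrow> complex. clinear_on UNIV g \<Longrightarrow> g x = g y"
  shows "x = y"
proof (rule ccontr)
  interpret vector_space_pair "(*\<^sub>C) :: complex \<Rightarrow> 'a \<Rightarrow> 'a" "(*\<^sub>C) :: complex \<Rightarrow> complex \<Rightarrow> complex" ..
  assume "x \<noteq> y"
  then have "complex_vector.independent {x - y}" by simp
  then obtain g :: "'a \<Rightarrow> complex" where g: "Vector_Spaces.linear (*\<^sub>C) (*\<^sub>C) g" "g (x - y) = 1"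
    using linear_independent_extend[of "{x - y}" "\<lambda>_. 1"] by auto
  have "g x = g (x - y) + g y"
    using linear_add[OF g(1), of "x - y" y] by simp
  with assms[of g] g show False by (simp add: clinear_on_UNIV_iff)
qed

subsection \<open>Evaluation on the algebraic tensor product\<close>

lemma subspace_Pol: "complex_vector.subspace (Pol G)"
  by (simp add: Pol_def)

text \<open>After composition with a functional \<open>g\<close>, the universal property yields a
  linear \<open>F\<close> on the algebraic tensor product, and both sums become values of
  \<open>F\<close> at the same tensor.\<close>

lemma pol_tensor_eval_unique:
  fixes G :: "('a::cstar_algebra, 'b::cstar_algebra, 'c::cstar_algebra) quantum_group"
    and B :: "'a \<Rightarrow> 'a \<Rightarrow> 'v::complex_vector"
  assumes G: "compact_quantum_group G" and B: "cbilinear B"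
    and eq: "(\<Sum>i<(n::nat). tens G (a i) (b i)) = (\<Sum>i<(m::nat). tens G (a' i) (b' i))"
  shows "(\<Sum>i<(n::nat). B (a i) (b i)) = (\<Sum>i<(m::nat). B (a' i) (b' i))"
proof (rule clinear_separating)
  fix g :: "'v \<Rightarrow> complex" assume g: "clinear_on UNIV g"
  have "cbilinear (\<lambda>a b. g (B a b))"
    using B g unfolding cbilinear_def clinear_on_def by simp
  then obtain F where F: "clinear_on (alg_tensor (tens G)) F" "\<And>a b. F (tens G a b) = g (B a b)"
    using G unfolding compact_quantum_group_def minimal_tensor_product_def by meson
  have V: "complex_vector.subspace (alg_tensor (tens G))" by (simp add: alg_tensor_def)
  have T: "tens G a b \<in> alg_tensor (tens G)" for a b
    unfolding alg_tensor_def by (rule complex_vector.span_base) auto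
  have "g (\<Sum>i<n. B (a i) (b i)) = F (\<Sum>i<(n::nat). tens G (a i) (b i))" for n and a b :: "nat \<Rightarrow> 'a"
    by (simp add: clinear_on_sum[OF g] clinear_on_sum[OF F(1) V] T F(2))
  with eq show "g (\<Sum>i<n. B (a i) (b i)) = g (\<Sum>i<m. B (a' i) (b' i))" by metis
qed

text \<open>This justifies the definite description in \<open>pol_tensor_eval\<close>. Agreement on
  \<open>Pol G\<close> with a globally bilinear \<open>B'\<close> is what functionals defined on
  \<open>Pol G\<close> can provide after extension.\<close>

lemma pol_tensor_eval_sum:
  fixes G :: "('a::cstar_algebra, 'b::cstar_algebra, 'c::cstar_algebra) quantum_group"
    and B :: "'a \<Rightarrow> 'a \<Rightarrow> 'v::complex_vector"
  assumes G: "compact_quantum_group G" and B': "cbilinear B'"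
    and eq: "\<And>a b. a \<in> Pol G \<Longrightarrow> b \<in> Pol G \<Longrightarrow> B a b = B' a b"
    and ab: "\<And>i. i < n \<Longrightarrow> a i \<in> Pol G" "\<And>i. i < n \<Longrightarrow> b i \<in> Pol G"
  shows "pol_tensor_eval G B (\<Sum>i<(n::nat). tens G (a i) (b i)) = (\<Sum>i<n. B (a i) (b i))"
  unfolding pol_tensor_eval_def
proof (rule the_equality)
  show "\<exists>m c d. (\<forall>i<m. c i \<in> Pol G \<and> d i \<in> Pol G) \<and>
     (\<Sum>i<(n::nat). tens G (a i) (b i)) = (\<Sum>i<(m::nat). tens G (c i) (d i)) \<and> (\<Sum>i<n. B (a i) (b i)) = (\<Sum>i<m. B (c i) (d i))"
    using ab by (intro exI[of _ n] exI[of _ a] exI[of _ b]) auto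
next
  fix w
  assume "\<exists>m c d. (\<forall>i<m. c i \<in> Pol G \<and> d i \<in> Pol G) \<and>
     (\<Sum>i<(n::nat). tens G (a i) (b i)) = (\<Sum>i<(m::nat). tens G (c i) (d i)) \<and> w = (\<Sum>i<m. B (c i) (d i))"
  then obtain m c d where *: "\<forall>i<m. c i \<in> Pol G \<and> d i \<in> Pol G"
     "(\<Sum>i<(n::nat). tens G (a i) (b i)) = (\<Sum>i<(m::nat). tens G (c i) (d i))" "w = (\<Sum>i<m. B (c i) (d i))"
    by blast
  have "(\<Sum>i<n. B (a i) (b i)) = (\<Sum>i<n. B' (a i) (b i))" "w = (\<Sum>i<m. B' (c i) (d i))"
    using ab * eq by auto
  then show "w = (\<Sum>i<n. B (a i) (b i))"
    using pol_tensor_eval_unique[OF G B' *(2)] by simp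
qed

lemma bilinear_extension_id_tensor:
  fixes \<phi> :: "'a::cstar_algebra \<Rightarrow> complex"
  assumes "clinear_on (Pol G) \<phi>"
  obtains B :: "'a \<Rightarrow> 'a \<Rightarrow> 'a" where "cbilinear B" "\<And>a b. b \<in> Pol G \<Longrightarrow> \<phi> b *\<^sub>C a = B a b"
proof -
  obtain \<phi>' where \<phi>': "clinear_on UNIV \<phi>'" "\<And>x. x \<in> Pol G \<Longrightarrow> \<phi>' x = \<phi> x"
    using clinear_on_extend[OF assms subspace_Pol] by blast
  have "cbilinear (\<lambda>a b. \<phi>' b *\<^sub>C (a :: 'a))"
    using \<phi>'(1) by (auto simp: cbilinear_def clinear_on_def scaleC_add_left scaleC_add_right
        scaleC_scaleC scaleC_complex_def mult.commute)
  with \<phi>'(2) that show thesis by metis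
qed

lemma bilinear_extension_convolution:
  fixes \<phi> \<psi> :: "'a::cstar_algebra \<Rightarrow> complex"
  assumes "clinear_on (Pol G) \<phi>" "clinear_on (Pol G) \<psi>"
  obtains B where "cbilinear B" "\<And>a b. a \<in> Pol G \<Longrightarrow> b \<in> Pol G \<Longrightarrow> \<phi> a * \<psi> b = B a b"
proof -
  obtain \<phi>' where \<phi>': "clinear_on UNIV \<phi>'" "\<And>x. x \<in> Pol G \<Longrightarrow> \<phi>' x = \<phi> x"
    using clinear_on_extend[OF assms(1) subspace_Pol] by blast
  obtain \<psi>' where \<psi>': "clinear_on UNIV \<psi>'" "\<And>x. x \<in> Pol G \<Longrightarrow> \<psi>' x = \<psi> x"
    using clinear_on_extend[OF assms(2) subspace_Pol] by blast
  have "cbilinear (\<lambda>a b. \<phi>' a * \<psi>' b)"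
    using \<phi>'(1) \<psi>'(1) by (auto simp: cbilinear_def clinear_on_def algebra_simps scaleC_complex_def)
  with \<phi>'(2) \<psi>'(2) that show thesis by metis
qed

text \<open>The image of the algebraic tensor square of \<open>Pol G\<close>, written with the same
  finite sums as in \<open>pol_tensor_eval\<close> so that a representation of a tensor can be
  passed on unchanged.\<close>

definition Pol_tensor_Pol ::
    "('a::cstar_algebra, 'b::cstar_algebra, 'c::cstar_algebra) quantum_group \<Rightarrow> 'b set" where
  "Pol_tensor_Pol G = {\<Sum>i<(n::nat). tens G (a i) (b i) | n a b. \<forall>i<n. a i \<in> Pol G \<and> b i \<in> Pol G}"

lemma Pol_tensor_PolE:
  assumes "z \<in> Pol_tensor_Pol G"
  obtains n :: nat and a b where "z = (\<Sum>i<(n::nat). tens G (a i) (b i))" "\<forall>i<n. a i \<in> Pol G \<and> b i \<in> Pol G"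
  using assms unfolding Pol_tensor_Pol_def by blast

lemma Pol_tensor_PolI:
  assumes "z = (\<Sum>i<(n::nat). tens G (a i) (b i))" "\<forall>i<n. a i \<in> Pol G \<and> b i \<in> Pol G"
  shows "z \<in> Pol_tensor_Pol G"
  unfolding Pol_tensor_Pol_def
  by (rule CollectI, rule exI[of _ n], rule exI[of _ a], rule exI[of _ b]) (use assms in simp)

lemma sum_lessThan_append:
  "(\<Sum>i<n. f i) + (\<Sum>i<m. g i) = (\<Sum>i<n + m. if i < n then f i else g (i - n))"
  for f g :: "nat \<Rightarrow> 'a::comm_monoid_add"
proof -
  have "(\<Sum>i<n + m. if i < n then f i else g (i - n))
      = (\<Sum>i<n. if i < n then f i else g (i - n)) + (\<Sum>i\<in>{n..<n + m}. if i < n then f i else g (i - n))"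
    by (subst sum.union_disjoint[symmetric]) (auto intro!: sum.cong)
  also have "(\<Sum>i\<in>{n..<n + m}. if i < n then f i else g (i - n)) = (\<Sum>i<m. g i)"
    by (rule sum.reindex_bij_witness[of _ "\<lambda>i. n + i" "\<lambda>i. i - n"]) auto
  finally show ?thesis by simp
qed

lemma tens_scaleC_left:
  assumes "compact_quantum_group G"
  shows "tens G (c *\<^sub>C a) b = c *\<^sub>C tens G a b"
  using assms by (auto simp: compact_quantum_group_def minimal_tensor_product_def cbilinear_def clinear_on_def)

lemma pol_tensor_eval_clinear:
  fixes G :: "('a::cstar_algebra, 'b::cstar_algebra, 'c::cstar_algebra) quantum_group"
    and B :: "'a \<Rightarrow> 'a \<Rightarrow> 'v::complex_vector"
  assumes G: "compact_quantum_group G" and B': "cbilinear B'"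
    and eq: "\<And>a b. a \<in> Pol G \<Longrightarrow> b \<in> Pol G \<Longrightarrow> B a b = B' a b"
  shows "clinear_on (Pol_tensor_Pol G) (pol_tensor_eval G B)"
  unfolding clinear_on_def
proof (intro conjI ballI allI)
  note eval = pol_tensor_eval_sum[where B = B, OF G B' eq]
  fix z assume "z \<in> Pol_tensor_Pol G"
  then obtain n a b where z: "z = (\<Sum>i<(n::nat). tens G (a i) (b i))" and ab: "\<forall>i<n. a i \<in> Pol G \<and> b i \<in> Pol G"
    by (rule Pol_tensor_PolE)
  {
    fix w assume "w \<in> Pol_tensor_Pol G"
    then obtain m c d where w: "w = (\<Sum>i<(m::nat). tens G (c i) (d i))" and cd: "\<forall>i<m. c i \<in> Pol G \<and> d i \<in> Pol G"
      by (rule Pol_tensor_PolE)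
    \<comment> \<open>Concatenating the two families of elementary tensors represents
      \<open>z + w\<close> by a single sum, the form that \<open>eval\<close> accepts.\<close>
    define a' where "a' i = (if i < n then a i else c (i - n))" for i
    define b' where "b' i = (if i < n then b i else d (i - n))" for i
    have ab': "i < n + m \<Longrightarrow> a' i \<in> Pol G \<and> b' i \<in> Pol G" for i
      using ab cd by (auto simp: a'_def b'_def)
    have "z + w = (\<Sum>i<n + m. tens G (a' i) (b' i))"
      unfolding z w sum_lessThan_append by (intro sum.cong) (auto simp: a'_def b'_def)
    then have "pol_tensor_eval G B (z + w) = (\<Sum>i<n + m. B (a' i) (b' i))"
      using eval[of "n + m" a' b'] ab' by simp
    also have "\<dots> = (\<Sum>i<n. B (a i) (b i)) + (\<Sum>i<m. B (c i) (d i))"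
      unfolding sum_lessThan_append by (intro sum.cong) (auto simp: a'_def b'_def)
    finally show "pol_tensor_eval G B (z + w) = pol_tensor_eval G B z + pol_tensor_eval G B w"
      using ab cd eval unfolding z w by simp
  }
  fix k
  have *: "\<forall>i<n. k *\<^sub>C a i \<in> Pol G"
    using ab complex_vector.subspace_scale[OF subspace_Pol] by blast
  have "k *\<^sub>C z = (\<Sum>i<(n::nat). tens G (k *\<^sub>C a i) (b i))"
    by (simp add: z complex_vector.scale_sum_right tens_scaleC_left[OF G])
  then have "pol_tensor_eval G B (k *\<^sub>C z) = (\<Sum>i<n. B (k *\<^sub>C a i) (b i))"
    using eval[of n "\<lambda>i. k *\<^sub>C a i" b] * ab by simp
  also have "\<dots> = (\<Sum>i<n. k *\<^sub>C B (a i) (b i))"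
  proof (intro sum.cong refl)
    fix i assume "i \<in> {..<n}"
    then show "B (k *\<^sub>C a i) (b i) = k *\<^sub>C B (a i) (b i)"
      using ab * eq B' by (simp add: cbilinear_def clinear_on_def)
  qed
  finally show "pol_tensor_eval G B (k *\<^sub>C z) = k *\<^sub>C pol_tensor_eval G B z"
    using ab eval unfolding z by (simp add: complex_vector.scale_sum_right)
qed

lemma Pol_tensor_Pol_add:
  assumes "z \<in> Pol_tensor_Pol G" "w \<in> Pol_tensor_Pol G"
  shows "z + w \<in> Pol_tensor_Pol G"
proof -
  obtain n a b where z: "z = (\<Sum>i<(n::nat). tens G (a i) (b i))" and ab: "\<forall>i<n. a i \<in> Pol G \<and> b i \<in> Pol G"
    using assms(1) by (rule Pol_tensor_PolE)
  obtain m c d where w: "w = (\<Sum>i<(m::nat). tens G (c i) (d i))" and cd: "\<forall>i<m. c i \<in> Pol G \<and> d i \<in> Pol G"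
    using assms(2) by (rule Pol_tensor_PolE)
  have "z + w = (\<Sum>i<n + m. tens G (if i < n then a i else c (i - n)) (if i < n then b i else d (i - n)))"
    unfolding z w sum_lessThan_append by (intro sum.cong) auto
  moreover have "\<forall>i<n + m. (if i < n then a i else c (i - n)) \<in> Pol G \<and> (if i < n then b i else d (i - n)) \<in> Pol G"
    using ab cd by auto
  ultimately show ?thesis by (rule Pol_tensor_PolI)
qed

lemma subspace_Pol_tensor_Pol:
  assumes "compact_quantum_group G"
  shows "complex_vector.subspace (Pol_tensor_Pol G)"
proof (rule complex_vector.subspaceI)
  show "0 \<in> Pol_tensor_Pol G"
    unfolding Pol_tensor_Pol_def by (rule CollectI, rule exI[of _ 0]) simp
next
  fix c z assume "z \<in> Pol_tensor_Pol G"
  then obtain n a b where z: "z = (\<Sum>i<(n::nat). tens G (a i) (b i))" and ab: "\<forall>i<n. a i \<in> Pol G \<and> b i \<in> Pol G"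
    by (rule Pol_tensor_PolE)
  have "c *\<^sub>C z = (\<Sum>i<(n::nat). tens G (c *\<^sub>C a i) (b i))"
    by (simp add: z complex_vector.scale_sum_right tens_scaleC_left[OF assms])
  moreover have "\<forall>i<n. c *\<^sub>C a i \<in> Pol G \<and> b i \<in> Pol G"
    using ab complex_vector.subspace_scale[OF subspace_Pol] by blast
  ultimately show "c *\<^sub>C z \<in> Pol_tensor_Pol G" by (rule Pol_tensor_PolI)
qed (rule Pol_tensor_Pol_add)

lemma coeff_in_Pol:
  assumes "irreducible_corep G v" "i < dim_row v" "j < dim_row v"
  shows "v $$ (i, j) \<in> Pol G"
  unfolding Pol_def coeff_space_def
  by (rule complex_vector.span_base) (use assms in \<open>auto intro!: bexI[of _ v] complex_vector.span_base\<close>)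

lemma comult_coeff:
  assumes "unitary_corep G v" "i < dim_row v" "j < dim_row v"
  shows "comult G (v $$ (i, j)) = (\<Sum>k<dim_row v. tens G (v $$ (i, k)) (v $$ (k, j)))"
  using assms by (auto simp: unitary_corep_def)

lemma Pol_eq: "Pol G = cspan {v $$ (i, j) |v i j. irreducible_corep G v \<and> i < dim_row v \<and> j < dim_row v}"
    (is "_ = cspan ?S")
proof
  have "coeff_space v \<subseteq> cspan ?S" if "irreducible_corep G v" for v
    unfolding coeff_space_def by (rule complex_vector.span_mono) (use that in blast)
  then show "Pol G \<subseteq> cspan ?S"
    unfolding Pol_def by (intro complex_vector.span_minimal) auto
  show "cspan ?S \<subseteq> Pol G"
    by (rule complex_vector.span_minimal) (auto simp: coeff_in_Pol subspace_Pol)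
qed

text \<open>On matrix coefficients the corepresentation identity already displays such a sum, and
  linearity carries this over to the span. Hence the slice maps may be evaluated on the
  comultiplication.\<close>

lemma comult_Pol:
  assumes G: "compact_quantum_group G" and x: "x \<in> Pol G"
  shows "comult G x \<in> Pol_tensor_Pol G"
  using x unfolding Pol_eq
proof (induction rule: complex_vector.span_induct_alt)
  have lin: "clinear_on UNIV (comult G)" using G by (simp add: compact_quantum_group_def)
  {
    case base
    then show ?case
      using complex_vector.subspace_0[OF subspace_Pol_tensor_Pol[OF G]] by (simp add: clinear_on_zero[OF lin])
  next
    case (step c x y)
    then obtain v i j where v: "irreducible_corep G v" "i < dim_row v" "j < dim_row v" and x: "x = v $$ (i, j)"
      by blast
    then have "comult G x = (\<Sum>k<dim_row v. tens G (v $$ (i, k)) (v $$ (k, j)))"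
      by (simp add: comult_coeff irreducible_corep_def)
    then have "comult G x \<in> Pol_tensor_Pol G"
      using v coeff_in_Pol[OF v(1)] by (intro Pol_tensor_PolI[where n = "dim_row v"]) auto
    with step show ?case
      using complex_vector.subspace_add[OF subspace_Pol_tensor_Pol[OF G]]
        complex_vector.subspace_scale[OF subspace_Pol_tensor_Pol[OF G]] lin
      by (simp add: clinear_on_def)
  }
qed

lemma id_tensor_clinear:
  fixes G :: "('a::cstar_algebra, 'b::cstar_algebra, 'c::cstar_algebra) quantum_group"
  assumes G: "compact_quantum_group G" and \<phi>: "clinear_on (Pol G) \<phi>"
  shows "clinear_on (Pol G) (id_tensor G \<phi>)"
proof -
  obtain B :: "'a \<Rightarrow> 'a \<Rightarrow> 'a" where B: "cbilinear B" "\<And>a b. b \<in> Pol G \<Longrightarrow> \<phi> b *\<^sub>C a = B a b"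
    using bilinear_extension_id_tensor[OF \<phi>] by blast
  have "clinear_on (Pol_tensor_Pol G) (pol_tensor_eval G (\<lambda>a b. \<phi> b *\<^sub>C a))"
    by (rule pol_tensor_eval_clinear[OF G B(1)]) (use B in auto)
  moreover have "clinear_on UNIV (comult G)" using G by (simp add: compact_quantum_group_def)
  ultimately show ?thesis
    using comult_Pol[OF G] by (auto simp: id_tensor_def[abs_def] clinear_on_def)
qed

text \<open>In matrix form, the slice map multiplies \<open>v\<close> from the right by the scalar
  matrix of values of \<open>\<phi>\<close> on the entries of \<open>v\<close>.\<close>

lemma id_tensor_coeff:
  fixes G :: "('a::cstar_algebra, 'b::cstar_algebra, 'c::cstar_algebra) quantum_group"
  assumes G: "compact_quantum_group G" and \<phi>: "clinear_on (Pol G) \<phi>"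
    and v: "irreducible_corep G v" "i < dim_row v" "j < dim_row v"
  shows "id_tensor G \<phi> (v $$ (i, j)) = (\<Sum>k<dim_row v. \<phi> (v $$ (k, j)) *\<^sub>C v $$ (i, k))"
proof -
  obtain B :: "'a \<Rightarrow> 'a \<Rightarrow> 'a" where B: "cbilinear B" "\<And>a b. b \<in> Pol G \<Longrightarrow> \<phi> b *\<^sub>C a = B a b"
    using bilinear_extension_id_tensor[OF \<phi>] by blast
  have "comult G (v $$ (i, j)) = (\<Sum>k<dim_row v. tens G (v $$ (i, k)) (v $$ (k, j)))"
    using v by (simp add: comult_coeff irreducible_corep_def)
  then show ?thesis
    unfolding id_tensor_def
    using pol_tensor_eval_sum[OF G B(1), of "\<lambda>a b. \<phi> b *\<^sub>C a" "dim_row v" "\<lambda>k. v $$ (i, k)" "\<lambda>k. v $$ (k, j)"]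
      B(2) coeff_in_Pol[OF v(1)] v by simp
qed

text \<open>On the entries of one corepresentation, convolution is matrix multiplication, so a
  convolution semigroup becomes a semigroup of finite matrices.\<close>

lemma convolution_coeff:
  assumes G: "compact_quantum_group G" and \<phi>: "clinear_on (Pol G) \<phi>" "clinear_on (Pol G) \<psi>"
    and v: "irreducible_corep G v" "i < dim_row v" "j < dim_row v"
  shows "convolution G \<phi> \<psi> (v $$ (i, j)) = (\<Sum>k<dim_row v. \<phi> (v $$ (i, k)) * \<psi> (v $$ (k, j)))"
proof -
  obtain B where B: "cbilinear B" "\<And>a b. a \<in> Pol G \<Longrightarrow> b \<in> Pol G \<Longrightarrow> \<phi> a * \<psi> b = B a b"
    using bilinear_extension_convolution[OF \<phi>] by blast
  have "comult G (v $$ (i, j)) = (\<Sum>k<dim_row v. tens G (v $$ (i, k)) (v $$ (k, j)))"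
    using v by (simp add: comult_coeff irreducible_corep_def)
  then show ?thesis
    unfolding convolution_def
    using pol_tensor_eval_sum[OF G B(1), of "\<lambda>a b. \<phi> a * \<psi> b" "dim_row v" "\<lambda>k. v $$ (i, k)" "\<lambda>k. v $$ (k, j)"]
      B(2) coeff_in_Pol[OF v(1)] v by simp
qed

subsection \<open>The semigroup on coefficients\<close>

text \<open>Cut the interval from 0 to \<open>t\<close> into equal steps of length
  \<open>h N\<close>. By the semigroup law each increment is a bounded matrix times
  \<open>F (h N) - F 0\<close>, which is o(\<open>h N\<close>); there are \<open>t / h N\<close>
  increments, so their sum tends to 0. Only differentiability at 0 enters.\<close>

lemma matrix_semigroup_stationary:
  fixes F :: "real \<Rightarrow> nat \<Rightarrow> nat \<Rightarrow> complex"
  assumes sg: "\<And>s t i j. s \<ge> 0 \<Longrightarrow> t \<ge> 0 \<Longrightarrow> i < d \<Longrightarrow> j < d \<Longrightarrow> F (s + t) i j = (\<Sum>k<d. F s i k * F t k j)"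
    and cont: "\<And>i j. i < d \<Longrightarrow> j < d \<Longrightarrow> continuous_on {0..} (\<lambda>t. F t i j)"
    and F0: "\<And>i j. i < d \<Longrightarrow> j < d \<Longrightarrow> F 0 i j = (if i = j then 1 else 0)"
    and der: "\<And>i j. i < d \<Longrightarrow> j < d \<Longrightarrow> ((\<lambda>t. F t i j) has_vector_derivative 0) (at 0 within {0..})"
    and t: "t > 0" and ij: "i < d" "j < d"
  shows "F t i j = F 0 i j"
proof -
  have "\<exists>M. \<forall>s\<in>{0..t}. cmod (F s i k) \<le> M" if "k < d" for k
  proof -
    have "compact ((\<lambda>s. F s i k) ` {0..t})"
      by (rule compact_continuous_image) (auto intro: continuous_on_subset[OF cont[OF ij(1) that]])
    then show ?thesis
      using compact_imp_bounded bounded_iff by (metis imageI)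
  qed
  \<comment> \<open>The bounds come from continuity on a compact interval and hold for all partition
    points at once.\<close>
  then obtain M where M: "\<And>k s. k < d \<Longrightarrow> s \<in> {0..t} \<Longrightarrow> cmod (F s i k) \<le> M k" by metis
  \<comment> \<open>Dividing by \<open>Suc N\<close> keeps the step length positive for every
    \<open>N\<close>.\<close>
  define h where "h N = t / real (Suc N)" for N
  have h: "h N > 0" for N using t by (simp add: h_def)
  have quot: "(\<lambda>N. inverse (h N) * cmod (F (h N) k j - F 0 k j)) \<longlonglongrightarrow> 0" if "k < d" for k
  proof -
    have "((\<lambda>y. (1 / norm (y - 0)) *\<^sub>R (F y k j - (F 0 k j + (y - 0) *\<^sub>R 0))) \<longlongrightarrow> 0) (at 0 within {0..})"
      using der[OF that ij(2)] unfolding has_vector_derivative_def has_derivative_within by blast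
    moreover have "filterlim h (at 0 within {0..}) sequentially"
    proof -
      have "h \<longlonglongrightarrow> 0"
        unfolding h_def using LIMSEQ_Suc[OF lim_const_over_n[of t]] by simp
      then show ?thesis
        using h by (auto simp: filterlim_at less_le intro!: always_eventually)
    qed
    ultimately have "(\<lambda>N. (1 / norm (h N - 0)) *\<^sub>R (F (h N) k j - (F 0 k j + (h N - 0) *\<^sub>R 0))) \<longlonglongrightarrow> 0"
      by (rule filterlim_compose)
    then have "(\<lambda>N. norm ((1 / norm (h N - 0)) *\<^sub>R (F (h N) k j - (F 0 k j + (h N - 0) *\<^sub>R 0)))) \<longlonglongrightarrow> 0"
      by (rule tendsto_norm_zero)
    then show ?thesis using h by (simp add: abs_of_pos inverse_eq_divide)
  qed
  have bound: "cmod (F t i j - F 0 i j) \<le> (\<Sum>k<d. M k * t * (inverse (h N) * cmod (F (h N) k j - F 0 k j)))" for N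
  proof -
    define f where "f m = F (real m * h N) i j" for m
    have hN: "real (Suc N) * h N = t" by (simp add: h_def)
    have "F t i j - F 0 i j = (\<Sum>m<Suc N. f (Suc m) - f m)"
      unfolding sum_lessThan_telescope using hN by (simp add: f_def)
    also have "cmod \<dots> \<le> (\<Sum>m<Suc N. \<Sum>k<d. M k * cmod (F (h N) k j - F 0 k j))"
    proof (rule sum_norm_le)
      fix m assume m: "m \<in> {..<Suc N}"
      have mh: "real m * h N \<in> {0..t}"
      proof -
        have "real m * h N \<le> real (Suc N) * h N" using m h[of N] by (intro mult_right_mono) auto
        then show ?thesis using hN h[of N] by (simp del: of_nat_Suc)
      qed
      have "f (Suc m) = (\<Sum>k<d. F (real m * h N) i k * F (h N) k j)"
        unfolding f_def using sg[of "real m * h N" "h N" i j] mh h[of N] ij by (simp add: algebra_simps)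
      moreover have "f m = (\<Sum>k<d. F (real m * h N) i k * F 0 k j)"
        unfolding f_def using sg[of "real m * h N" 0 i j] mh ij by simp
      ultimately have "f (Suc m) - f m = (\<Sum>k<d. F (real m * h N) i k * (F (h N) k j - F 0 k j))"
        by (simp add: sum_subtractf right_diff_distrib)
      also have "cmod \<dots> \<le> (\<Sum>k<d. M k * cmod (F (h N) k j - F 0 k j))"
        by (rule sum_norm_le) (auto simp: norm_mult intro!: mult_right_mono M mh)
      finally show "cmod (f (Suc m) - f m) \<le> (\<Sum>k<d. M k * cmod (F (h N) k j - F 0 k j))" .
    qed
    also have "\<dots> = (\<Sum>k<d. M k * t * (inverse (h N) * cmod (F (h N) k j - F 0 k j)))"
    proof -
      \<comment> \<open>The number of steps is rewritten as \<open>t / h N\<close> to expose the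
        difference quotients, which tend to 0 by \<open>quot\<close>.\<close>
      have "t * inverse (h N) = real (Suc N)" using t by (simp add: h_def del: of_nat_Suc)
      then have "M k * t * (inverse (h N) * x) = real (Suc N) * (M k * x)" for k x
        by (metis mult.assoc mult.commute)
      then show ?thesis by (simp only: sum_constant card_lessThan sum_distrib_left)
    qed
    finally show ?thesis .
  qed
  have "(\<lambda>N. \<Sum>k<d. M k * t * (inverse (h N) * cmod (F (h N) k j - F 0 k j))) \<longlonglongrightarrow> (\<Sum>k<d. M k * t * 0)"
    by (intro tendsto_sum tendsto_mult tendsto_const quot) auto
  then have "(\<lambda>N. \<Sum>k<d. M k * t * (inverse (h N) * cmod (F (h N) k j - F 0 k j))) \<longlonglongrightarrow> 0" by simp
  then have "cmod (F t i j - F 0 i j) \<le> 0"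
    by (rule LIMSEQ_le_const) (use bound in blast)
  then show ?thesis by simp
qed

text \<open>Multiplication by the scalar semigroup \<open>exp (- l * t)\<close> preserves the
  semigroup law and makes the derivative at 0 vanish, so the stationary case applies to
  \<open>H\<close>.\<close>

lemma matrix_semigroup_exp:
  fixes F :: "real \<Rightarrow> nat \<Rightarrow> nat \<Rightarrow> complex" and l :: real
  assumes sg: "\<And>s t i j. s \<ge> 0 \<Longrightarrow> t \<ge> 0 \<Longrightarrow> i < d \<Longrightarrow> j < d \<Longrightarrow> F (s + t) i j = (\<Sum>k<d. F s i k * F t k j)"
    and cont: "\<And>i j. i < d \<Longrightarrow> j < d \<Longrightarrow> continuous_on {0..} (\<lambda>t. F t i j)"
    and F0: "\<And>i j. i < d \<Longrightarrow> j < d \<Longrightarrow> F 0 i j = (if i = j then 1 else 0)"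
    and der: "\<And>i j. i < d \<Longrightarrow> j < d \<Longrightarrow>
      ((\<lambda>t. F t i j) has_vector_derivative (if i = j then of_real l else 0)) (at 0 within {0..})"
    and t: "t > 0" and ij: "i < d" "j < d"
  shows "F t i j = (if i = j then exp (of_real (l * t)) else 0)"
proof -
  define H where "H t i j = exp (- (of_real l * of_real t)) * F t i j" for t i j
  have "H t i j = H 0 i j"
  proof (rule matrix_semigroup_stationary[of d H])
    fix s t :: real and i j assume "s \<ge> 0" "t \<ge> 0" "i < d" "j < d"
    moreover have "exp (- (complex_of_real l * of_real (s + t)))
        = exp (- (of_real l * of_real s)) * exp (- (of_real l * of_real t))"
      by (simp add: algebra_simps flip: exp_add)
    ultimately show "H (s + t) i j = (\<Sum>k<d. H s i k * H t k j)"
      by (simp add: H_def sg sum_distrib_left mult_ac del: of_real_add)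
  next
    fix i j assume ij: "i < d" "j < d"
    show "continuous_on {0..} (\<lambda>t. H t i j)"
      unfolding H_def by (intro continuous_intros cont ij)
    show "H 0 i j = (if i = j then 1 else 0)" by (simp add: H_def F0 ij)
    \<comment> \<open>By the product rule the scalar factor contributes \<open>- l\<close> on the
      diagonal at 0, which cancels the derivative of \<open>F\<close>.\<close>
    have "((\<lambda>t. exp (- (of_real l * of_real t))) has_vector_derivative (- of_real l :: complex)) (at 0 within {0..})"
      by (auto intro!: derivative_eq_intros has_vector_derivative_real_field)
    from has_vector_derivative_mult[OF this der[OF ij]]
    show "((\<lambda>t. H t i j) has_vector_derivative 0) (at 0 within {0..})"
      unfolding H_def using ij by (simp add: F0 split: if_splits)
  qed (use t ij in auto)
  then have "F t i j = exp (of_real l * of_real t) * F 0 i j"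
    by (simp add: H_def exp_minus field_simps)
  then show ?thesis by (simp add: F0 ij)
qed

section \<open>The involution and unitary corepresentations in coordinates\<close>

lemma star_0 [simp]: "star (0::'a::cstar_algebra) = 0"
  using star_scaleC[of 0 "0::'a"] by simp

lemma star_1 [simp]: "star (1::'a::cstar_algebra) = 1"
  using star_mult[of "star (1::'a)" 1] star_star[of "1::'a"] by simp

lemma star_sum: "star (\<Sum>i\<in>I. f i) = (\<Sum>i\<in>I. star (f i :: 'a::cstar_algebra))"
  by (induction I rule: infinite_finite_induct) (auto simp: star_add)

lemma unitary_corep_dim: "unitary_corep G u \<Longrightarrow> dim_col u = dim_row u"
  by (simp add: unitary_corep_def)

lemma unitary_corep_star_mult:
  assumes u: "unitary_corep G u" and ij: "i < dim_row u" "j < dim_row u"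
  shows "(\<Sum>k<dim_row u. star (u $$ (k, i)) * u $$ (k, j)) = (if i = j then 1 else 0)"
proof -
  have "(star_mat u * u) $$ (i, j) = (if i = j then 1 else 0)"
    using u ij by (simp add: unitary_corep_def)
  moreover have "(star_mat u * u) $$ (i, j) = (\<Sum>k<dim_row u. star (u $$ (k, i)) * u $$ (k, j))"
    using ij unitary_corep_dim[OF u] by (simp add: star_mat_def scalar_prod_def atLeast0LessThan)
  ultimately show ?thesis by simp
qed

lemma unitary_corep_mult_star:
  assumes u: "unitary_corep G u" and ij: "i < dim_row u" "j < dim_row u"
  shows "(\<Sum>k<dim_row u. u $$ (i, k) * star (u $$ (j, k))) = (if i = j then 1 else 0)"
proof -
  have "(u * star_mat u) $$ (i, j) = (if i = j then 1 else 0)"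
    using u ij by (simp add: unitary_corep_def)
  moreover have "(u * star_mat u) $$ (i, j) = (\<Sum>k<dim_row u. u $$ (i, k) * star (u $$ (j, k)))"
    using ij unitary_corep_dim[OF u] by (simp add: star_mat_def scalar_prod_def atLeast0LessThan)
  ultimately show ?thesis by simp
qed

text \<open>The hypothesis says that \<open>u\<close> maps the scalar vector \<open>c\<close> to
  \<open>x\<close> times column \<open>j\<close> of \<open>u\<close>. Multiplication by the adjoint
  of \<open>u\<close>, its inverse, recovers \<open>c\<close>. This extracts the scalars
  \<open>L (v $$ (p, j))\<close> from an identity between algebra elements.\<close>

lemma unitary_corep_coordinates:
  assumes u: "unitary_corep G u" and p: "p < dim_row u"
    and eq: "\<And>i. i < dim_row u \<Longrightarrow> (\<Sum>k<dim_row u. c k *\<^sub>C u $$ (i, k)) = x *\<^sub>C u $$ (i, j)"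
    and j: "j < dim_row u"
  shows "c p = (if p = j then x else 0)"
proof -
  let ?d = "dim_row u"
  have "c p *\<^sub>C 1 = (\<Sum>k<?d. c k *\<^sub>C (if p = k then 1 else 0))"
    using p by (simp add: if_distrib[of "(*\<^sub>C) _"] cong: if_cong)
  also have "\<dots> = (\<Sum>k<?d. \<Sum>i<?d. c k *\<^sub>C (star (u $$ (i, p)) * u $$ (i, k)))"
    using p by (simp add: unitary_corep_star_mult[OF u, symmetric] complex_vector.scale_sum_right)
  also have "\<dots> = (\<Sum>i<?d. \<Sum>k<?d. c k *\<^sub>C (star (u $$ (i, p)) * u $$ (i, k)))"
    by (rule sum.swap)
  also have "\<dots> = (\<Sum>i<?d. star (u $$ (i, p)) * (\<Sum>k<?d. c k *\<^sub>C u $$ (i, k)))"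
    by (simp add: sum_distrib_left mult_scaleC_right)
  also have "\<dots> = (\<Sum>i<?d. x *\<^sub>C (star (u $$ (i, p)) * u $$ (i, j)))"
    by (simp add: eq mult_scaleC_right)
  also have "\<dots> = x *\<^sub>C (if p = j then 1 else 0)"
    using p j by (simp add: unitary_corep_star_mult[OF u] flip: complex_vector.scale_sum_right)
  finally show ?thesis by (auto split: if_splits)
qed

text \<open>Both sides of each linearity law are derivatives at 0 of the same function of
  \<open>t\<close> on the half-line, where each \<open>\<phi> t\<close> is linear; uniqueness of the
  derivative gives the law.\<close>

lemma generating_functional_clinear:
  assumes \<phi>: "convolution_semigroup G \<phi>" and L: "generating_functional G \<phi> L"
  shows "clinear_on (Pol G) L"
proof -
  have lin: "clinear_on (Pol G) (\<phi> t)" if "t \<ge> 0" for t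
    using \<phi> that by (simp add: convolution_semigroup_def state_on_def)
  have der: "((\<lambda>t. \<phi> t x) has_vector_derivative L x) (at 0 within {0..})" if "x \<in> Pol G" for x
    using L that by (simp add: generating_functional_def)
  have nontriv: "at (0::real) within {0..} \<noteq> bot"
    by (simp add: at_within_Ici_at_right)
  have unique: "a = b" if "((\<lambda>t. \<phi> t x) has_vector_derivative a) (at 0 within {0..})"
      "(f has_vector_derivative b) (at 0 within {0..})" "\<And>t. t \<ge> 0 \<Longrightarrow> f t = \<phi> t x" for a b f x
    using vector_derivative_unique_within[OF nontriv that(1)]
      has_vector_derivative_transform[of 0 "{0..}" "\<lambda>t. \<phi> t x" f b] that(2,3) by auto
  show ?thesis
    unfolding clinear_on_def
  proof (intro conjI ballI allI)
    fix x y assume xy: "x \<in> Pol G" "y \<in> Pol G"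
    then have "x + y \<in> Pol G" by (rule complex_vector.subspace_add[OF subspace_Pol])
    then show "L (x + y) = L x + L y"
      using unique[OF der has_vector_derivative_add[OF der[OF xy(1)] der[OF xy(2)]]] xy
      by (simp add: clinear_on_add[OF lin])
  next
    fix c x assume x: "x \<in> Pol G"
    then have "c *\<^sub>C x \<in> Pol G" by (rule complex_vector.subspace_scale[OF subspace_Pol])
    then show "L (c *\<^sub>C x) = c *\<^sub>C L x"
      using unique[OF der has_vector_derivative_mult_right[OF der[OF x], of c]] x
      by (simp add: clinear_on_scaleC[OF lin] scaleC_complex_def)
  qed
qed

text \<open>The eigenvalue equation makes the matrix of \<open>L\<close> equal to \<open>l\<close>
  times the identity, and the counit property makes the matrix of \<open>\<phi> 0\<close> the
  identity. The matrices of \<open>\<phi> t\<close> are then the scalar exponentials, and the slice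
  formula turns this into the action on coefficients.\<close>

lemma markov_semigroup_coeff:
  assumes G: "compact_quantum_group G" and \<phi>: "convolution_semigroup G \<phi>" and L: "generating_functional G \<phi> L"
    and v: "irreducible_corep G v" and t: "t > 0"
    and eig: "\<And>x. x \<in> coeff_space v \<Longrightarrow> id_tensor G L x = l *\<^sub>R x"
    and ij: "i < dim_row v" "j < dim_row v"
  shows "id_tensor G (\<phi> t) (v $$ (i, j)) = exp (of_real (l * t)) *\<^sub>C v $$ (i, j)"
proof -
  let ?d = "dim_row v"
  have u: "unitary_corep G v" using v by (simp add: irreducible_corep_def)
  have lin: "clinear_on (Pol G) (\<phi> t)" if "t \<ge> 0" for t
    using \<phi> that by (simp add: convolution_semigroup_def state_on_def)
  have Lv: "L (v $$ (p, j)) = (if p = j then of_real l else 0)" if "p < ?d" "j < ?d" for p j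
  proof (rule unitary_corep_coordinates[OF u that(1) _ that(2)])
    fix i assume i: "i < ?d"
    have "v $$ (i, j) \<in> coeff_space v"
      unfolding coeff_space_def by (rule complex_vector.span_base) (use i that in blast)
    then show "(\<Sum>k<?d. L (v $$ (k, j)) *\<^sub>C v $$ (i, k)) = of_real l *\<^sub>C v $$ (i, j)"
      using id_tensor_coeff[OF G generating_functional_clinear[OF \<phi> L] v i that(2)]
      by (simp add: eig scaleR_scaleC)
  qed
  have \<phi>0: "\<phi> 0 (v $$ (p, j)) = (if p = j then 1 else 0)" if "p < ?d" "j < ?d" for p j
  proof (rule unitary_corep_coordinates[OF u that(1) _ that(2)])
    fix i assume i: "i < ?d"
    have "id_tensor G (\<phi> 0) (v $$ (i, j)) = v $$ (i, j)"
      using \<phi> coeff_in_Pol[OF v i that(2)] by (simp add: convolution_semigroup_def counit_def)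
    then show "(\<Sum>k<?d. \<phi> 0 (v $$ (k, j)) *\<^sub>C v $$ (i, k)) = 1 *\<^sub>C v $$ (i, j)"
      using id_tensor_coeff[OF G lin v i that(2), of 0] by simp
  qed
  have \<phi>t: "\<phi> t (v $$ (p, j)) = (if p = j then exp (of_real (l * t)) else 0)" if pj: "p < ?d" "j < ?d" for p j
  proof (rule matrix_semigroup_exp[of ?d "\<lambda>t i j. \<phi> t (v $$ (i, j))"])
    fix s t :: real and i j assume *: "s \<ge> 0" "t \<ge> 0" "i < ?d" "j < ?d"
    have "\<phi> (s + t) (v $$ (i, j)) = convolution G (\<phi> s) (\<phi> t) (v $$ (i, j))"
      using \<phi> * coeff_in_Pol[OF v *(3,4)] by (simp add: convolution_semigroup_def)
    with * show "\<phi> (s + t) (v $$ (i, j)) = (\<Sum>k<?d. \<phi> s (v $$ (i, k)) * \<phi> t (v $$ (k, j)))"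
      by (simp add: convolution_coeff[OF G lin lin v])
  next
    fix i j assume *: "i < ?d" "j < ?d"
    show "continuous_on {0..} (\<lambda>t. \<phi> t (v $$ (i, j)))"
      using \<phi> coeff_in_Pol[OF v *] by (simp add: convolution_semigroup_def)
    show "((\<lambda>t. \<phi> t (v $$ (i, j))) has_vector_derivative (if i = j then of_real l else 0)) (at 0 within {0..})"
      using L coeff_in_Pol[OF v *] Lv[OF *] unfolding generating_functional_def by metis
  qed (use \<phi>0 t pj in auto)
  have "id_tensor G (\<phi> t) (v $$ (i, j)) = (\<Sum>k<?d. \<phi> t (v $$ (k, j)) *\<^sub>C v $$ (i, k))"
    using id_tensor_coeff[OF G lin v ij] t by simp
  also have "\<dots> = (\<Sum>k<?d. if k = j then exp (of_real (l * t)) *\<^sub>C v $$ (i, k) else 0)"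
    by (intro sum.cong) (auto simp: \<phi>t ij)
  also have "\<dots> = exp (of_real (l * t)) *\<^sub>C v $$ (i, j)"
    using ij by simp
  finally show ?thesis .
qed

subsection \<open>Orthogonality relations\<close>

text \<open>Multiplicativity on elementary tensors makes \<open>tens G 1 1\<close> a left unit
  there; density of their span and continuity of multiplication make it a left unit everywhere, in
  particular on 1.\<close>

lemma tens_one:
  assumes "compact_quantum_group G"
  shows "tens G 1 1 = 1"
proof -
  have mtp: "minimal_tensor_product (tens G)" using assms by (simp add: compact_quantum_group_def)
  have "alg_tensor (tens G) \<subseteq> {z. tens G 1 1 * z = z}"
    unfolding alg_tensor_def
  proof (rule complex_vector.span_minimal)
    show "range (\<lambda>(a, b). tens G a b) \<subseteq> {z. tens G 1 1 * z = z}"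
      using mtp by (auto simp: minimal_tensor_product_def)
    show "complex_vector.subspace {z. tens G 1 1 * z = z}"
      by (rule complex_vector.subspaceI) (auto simp: distrib_left mult_scaleC_right)
  qed
  moreover have "closed {z. tens G 1 1 * z = z}"
    by (intro closed_Collect_eq continuous_intros)
  ultimately have "closure (alg_tensor (tens G)) \<subseteq> {z. tens G 1 1 * z = z}"
    by (rule closure_minimal)
  moreover have "closure (alg_tensor (tens G)) = UNIV"
    using mtp by (simp add: minimal_tensor_product_def)
  ultimately have "1 \<in> {z. tens G 1 1 * z = z}" by blast
  then show ?thesis by simp
qed

text \<open>The unit is the only coefficient of the trivial one-dimensional corepresentation, which
  is irreducible because every 1 by 1 matrix is scalar.\<close>

lemma one_in_Pol:
  fixes G :: "('a::cstar_algebra, 'b::cstar_algebra, 'c::cstar_algebra) quantum_group"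
  assumes G: "compact_quantum_group G"
  shows "1 \<in> Pol G"
proof -
  let ?v = "1\<^sub>m 1 :: 'a mat"
  have "star_mat ?v = ?v" by (rule eq_matI) (auto simp: star_mat_def)
  moreover have "comult G 1 = 1" using G by (simp add: compact_quantum_group_def)
  ultimately have "unitary_corep G ?v"
    by (simp add: unitary_corep_def tens_one[OF G])
  moreover have "\<exists>c. X = c \<cdot>\<^sub>m 1\<^sub>m (dim_row ?v)" if "intertwiner ?v ?v X" for X
  proof
    show "X = X $$ (0, 0) \<cdot>\<^sub>m 1\<^sub>m (dim_row ?v)"
      using that by (intro eq_matI) (auto simp: intertwiner_def)
  qed
  ultimately have "irreducible_corep G ?v" by (simp add: irreducible_corep_def)
  from coeff_in_Pol[OF this, of 0 0] show ?thesis by simp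
qed

section \<open>Adjoints of intertwiners and Schur's lemma\<close>

lemma star_mat_mult:
  assumes "dim_col A = dim_row B"
  shows "star_mat (A * B) = star_mat B * star_mat A"
  using assms by (intro eq_matI) (auto simp: star_mat_def scalar_prod_def star_sum star_mult)

abbreviation scalar_mat :: "complex mat \<Rightarrow> 'a::cstar_algebra mat" where
  "scalar_mat \<equiv> map_mat (\<lambda>c. c *\<^sub>C 1)"

lemma scalar_mat_mult:
  assumes "dim_col X = dim_row Y"
  shows "(scalar_mat (X * Y) :: 'a::cstar_algebra mat) = scalar_mat X * scalar_mat Y"
  using assms by (intro eq_matI)
    (auto simp: scalar_prod_def complex_vector.scale_sum_left mult_scaleC_left scaleC_scaleC)

lemma scalar_mat_one [simp]: "scalar_mat (1\<^sub>m n) = 1\<^sub>m n"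
  by (intro eq_matI) auto

definition conj_transpose :: "complex mat \<Rightarrow> complex mat" where
  "conj_transpose X = map_mat cnj (transpose_mat X)"

lemma conj_transpose_carrier [simp]:
  "X \<in> carrier_mat m n \<Longrightarrow> conj_transpose X \<in> carrier_mat n m"
  by (simp add: conj_transpose_def)

lemma star_scalar_mat: "star_mat (scalar_mat X) = scalar_mat (conj_transpose X)"
  by (intro eq_matI) (auto simp: star_mat_def conj_transpose_def star_scaleC)

lemma unitary_corep_carrier:
  assumes "unitary_corep G u"
  obtains m where "m = dim_row u" "u \<in> carrier_mat m m" "star_mat u \<in> carrier_mat m m"
    "star_mat u * u = 1\<^sub>m m" "u * star_mat u = 1\<^sub>m m"
proof (rule that[of "dim_row u"])
  show "u \<in> carrier_mat (dim_row u) (dim_row u)" "star_mat u \<in> carrier_mat (dim_row u) (dim_row u)"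
    using unitary_corep_dim[OF assms] by (intro carrier_matI; simp add: star_mat_def)+
qed (use assms in \<open>auto simp: unitary_corep_def\<close>)

lemma intertwiner_conj_transpose:
  assumes u: "unitary_corep G u" and v: "unitary_corep G v" and X: "intertwiner u v X"
  shows "intertwiner v u (conj_transpose X)"
proof -
  obtain m where m: "m = dim_row u" and uc: "u \<in> carrier_mat m m" "star_mat u \<in> carrier_mat m m"
    and uu: "u * star_mat u = 1\<^sub>m m"
    using unitary_corep_dim[OF u] unitary_corep_carrier[OF u] by blast
  obtain n where n: "n = dim_row v" and vc: "v \<in> carrier_mat n n" "star_mat v \<in> carrier_mat n n"
    and vv: "star_mat v * v = 1\<^sub>m n"
    using unitary_corep_dim[OF v] unitary_corep_carrier[OF v] by blast
  let ?X = "scalar_mat X" and ?Y = "scalar_mat (conj_transpose X)"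
  have X': "X \<in> carrier_mat n m" and eq: "?X * u = v * ?X"
    using X unfolding intertwiner_def m n by blast+
  from X' have Xc: "?X \<in> carrier_mat n m" and Y: "?Y \<in> carrier_mat m n" by simp_all
  have "star_mat (?X * u) = star_mat (v * ?X)" by (simp only: eq)
  moreover have "star_mat (?X * u) = star_mat u * ?Y"
    using carrier_matD[OF Xc] carrier_matD[OF uc(1)] by (simp add: star_mat_mult star_scalar_mat)
  moreover have "star_mat (v * ?X) = ?Y * star_mat v"
    using carrier_matD[OF Xc] carrier_matD[OF vc(1)] by (simp add: star_mat_mult star_scalar_mat)
  ultimately have eq': "star_mat u * ?Y = ?Y * star_mat v" by simp
  \<comment> \<open>A factor \<open>u * star_mat u\<close> is inserted on the left; the adjoint
    relation \<open>eq'\<close> then moves the inner adjoint to the right, where it cancels against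
    \<open>v\<close>.\<close>
  have "?Y * v = (u * star_mat u) * (?Y * v)"
    unfolding uu using Y vc by simp
  also have "\<dots> = u * (star_mat u * (?Y * v))"
    using uc vc Y by (intro assoc_mult_mat) auto
  also have "star_mat u * (?Y * v) = star_mat u * ?Y * v"
    using uc vc Y by (intro assoc_mult_mat[symmetric])
  also have "\<dots> = ?Y * (star_mat v * v)"
    unfolding eq' using vc Y by (intro assoc_mult_mat)
  also have "\<dots> = ?Y" unfolding vv using Y by simp
  finally show ?thesis
    using conj_transpose_carrier[OF X'] unfolding intertwiner_def m n by blast
qed

lemma intertwiner_compose:
  assumes u: "unitary_corep G u" and v: "unitary_corep G v" and w: "unitary_corep G w"
    and X: "intertwiner u v X" and Y: "intertwiner v w Y"
  shows "intertwiner u w (Y * X)"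
proof -
  obtain m where m: "m = dim_row u" and uc: "u \<in> carrier_mat m m"
    using unitary_corep_dim[OF u] unitary_corep_carrier[OF u] by blast
  obtain n where n: "n = dim_row v" and vc: "v \<in> carrier_mat n n"
    using unitary_corep_dim[OF v] unitary_corep_carrier[OF v] by blast
  obtain k where k: "k = dim_row w" and wc: "w \<in> carrier_mat k k"
    using unitary_corep_dim[OF w] unitary_corep_carrier[OF w] by blast
  have c: "X \<in> carrier_mat n m" "Y \<in> carrier_mat k n"
    and eq: "scalar_mat X * u = v * scalar_mat X" "scalar_mat Y * v = w * scalar_mat Y"
    using X Y unfolding intertwiner_def m n k by blast+
  have c': "scalar_mat X \<in> carrier_mat n m" "scalar_mat Y \<in> carrier_mat k n"
    using c by simp_all
  have XY: "scalar_mat (Y * X) = scalar_mat Y * scalar_mat X"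
    using c by (intro scalar_mat_mult) auto
  have "scalar_mat (Y * X) * u = scalar_mat Y * (scalar_mat X * u)"
    using c' uc unfolding XY by (intro assoc_mult_mat)
  also have "\<dots> = scalar_mat Y * v * scalar_mat X"
    unfolding eq(1) using c' vc by (intro assoc_mult_mat[symmetric])
  also have "\<dots> = w * scalar_mat (Y * X)"
    unfolding eq(2) XY using c' wc by (intro assoc_mult_mat)
  finally show ?thesis
    using mult_carrier_mat[OF c(2,1)] unfolding intertwiner_def m k by blast
qed

text \<open>For an intertwiner \<open>X\<close> with adjoint \<open>?Y\<close>, both
  \<open>?Y * X\<close> and \<open>X * ?Y\<close> intertwine an irreducible corepresentation with
  itself and so are scalar. If \<open>X\<close> is nonzero, the two scalars are equal and nonzero
  and the dimensions agree, so a multiple of \<open>?Y\<close> inverts \<open>X\<close>,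
  contradicting inequivalence.\<close>

lemma schur_inequivalent:
  assumes u: "irreducible_corep G u" and v: "irreducible_corep G v"
    and neq: "\<not> equivalent_corep u v" and X: "intertwiner u v X"
  shows "X = 0\<^sub>m (dim_row v) (dim_row u)"
proof (rule ccontr)
  let ?Y = "conj_transpose X"
  assume X0': "X \<noteq> 0\<^sub>m (dim_row v) (dim_row u)"
  obtain m n where m: "m = dim_row u" and n: "n = dim_row v" by blast
  have X0: "X \<noteq> 0\<^sub>m n m" unfolding m n by (rule X0')
  have uu: "unitary_corep G u" "unitary_corep G v"
    using u v by (simp_all add: irreducible_corep_def)
  have Y: "intertwiner v u ?Y" by (rule intertwiner_conj_transpose[OF uu X])
  have c: "X \<in> carrier_mat n m" "?Y \<in> carrier_mat m n"
    using X Y unfolding intertwiner_def m n by blast+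
  obtain c where YX: "?Y * X = c \<cdot>\<^sub>m 1\<^sub>m m"
    using u intertwiner_compose[OF uu(1,2,1) X Y] unfolding m irreducible_corep_def by blast
  obtain d where XY: "X * ?Y = d \<cdot>\<^sub>m 1\<^sub>m n"
    using v intertwiner_compose[OF uu(2,1,2) Y X] unfolding n irreducible_corep_def by blast
  \<comment> \<open>All columns of \<open>X\<close> have the same squared norm \<open>c\<close>;
    below, all rows have the same squared norm \<open>d\<close>.\<close>
  have YX_diag: "c = (\<Sum>i<n. of_real ((cmod (X $$ (i, j)))\<^sup>2))" if "j < m" for j
  proof -
    have "c = (?Y * X) $$ (j, j)" unfolding YX using that by simp
    also have "\<dots> = (\<Sum>i<n. cnj (X $$ (i, j)) * X $$ (i, j))"
      using c that by (simp add: scalar_prod_def conj_transpose_def atLeast0LessThan)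
    finally show ?thesis by (simp add: complex_norm_square mult.commute del: of_real_power)
  qed
  have XY_diag: "d = (\<Sum>j<m. of_real ((cmod (X $$ (i, j)))\<^sup>2))" if "i < n" for i
  proof -
    have "d = (X * ?Y) $$ (i, i)" unfolding XY using that by simp
    also have "\<dots> = (\<Sum>j<m. X $$ (i, j) * cnj (X $$ (i, j)))"
      using c that by (simp add: scalar_prod_def conj_transpose_def atLeast0LessThan)
    finally show ?thesis by (simp add: complex_norm_square del: of_real_power)
  qed
  have "c \<noteq> 0"
  proof
    assume "c = 0"
    have "X $$ (i, j) = 0" if "i < n" "j < m" for i j
    proof -
      have "complex_of_real (\<Sum>i<n. (cmod (X $$ (i, j)))\<^sup>2) = 0"
        using YX_diag[OF that(2)] \<open>c = 0\<close> by simp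
      then have "(\<Sum>i<n. (cmod (X $$ (i, j)))\<^sup>2) = 0" by (simp only: of_real_eq_0_iff)
      then have "\<forall>i\<in>{..<n}. (cmod (X $$ (i, j)))\<^sup>2 = 0"
        by (subst (asm) sum_nonneg_eq_0_iff) auto
      with that show ?thesis by simp
    qed
    then have "X = 0\<^sub>m n m" using c by (intro eq_matI) auto
    with X0 show False ..
  qed
  \<comment> \<open>The squared moduli of all entries of \<open>X\<close> are summed by columns and
    by rows, that is, the traces of the two products are compared.\<close>
  have "of_nat m * c = (\<Sum>j<m. c)" by simp
  also have "\<dots> = (\<Sum>j<m. \<Sum>i<n. complex_of_real ((cmod (X $$ (i, j)))\<^sup>2))"
    by (intro sum.cong refl YX_diag) auto
  also have "\<dots> = (\<Sum>i<n. \<Sum>j<m. complex_of_real ((cmod (X $$ (i, j)))\<^sup>2))"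
    by (rule sum.swap)
  also have "\<dots> = (\<Sum>i<n. d)"
    by (intro sum.cong refl XY_diag[symmetric]) auto
  also have "\<dots> = of_nat n * d" by simp
  finally have trace: "of_nat m * c = of_nat n * d" .
  \<comment> \<open>Bracketing the triple product in two ways identifies the scalars at a nonzero
    entry of \<open>X\<close>; the trace identity then forces equal dimensions.\<close>
  have "d \<cdot>\<^sub>m X = (X * ?Y) * X"
    unfolding XY using c by (simp add: mult_smult_assoc_mat[of _ n n _ m])
  also have "\<dots> = X * (?Y * X)" using c by (intro assoc_mult_mat)
  also have "\<dots> = c \<cdot>\<^sub>m X"
    unfolding YX using c by (simp add: mult_smult_distrib[of _ n m _ m])
  finally have dcX: "d \<cdot>\<^sub>m X = c \<cdot>\<^sub>m X" .
  obtain i j where ij: "i < n" "j < m" "X $$ (i, j) \<noteq> 0"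
  proof -
    have "\<not> (\<forall>i<n. \<forall>j<m. X $$ (i, j) = 0)"
    proof
      assume "\<forall>i<n. \<forall>j<m. X $$ (i, j) = 0"
      then have "X = 0\<^sub>m n m" using c by (intro eq_matI) auto
      with X0 show False ..
    qed
    with that show thesis by blast
  qed
  have "(d \<cdot>\<^sub>m X) $$ (i, j) = (c \<cdot>\<^sub>m X) $$ (i, j)" by (simp add: dcX)
  then have "d = c" using ij c by simp
  with trace \<open>c \<noteq> 0\<close> have "m = n" by simp
  have "X * (inverse c \<cdot>\<^sub>m ?Y) = 1\<^sub>m n"
  proof -
    have "X * (inverse c \<cdot>\<^sub>m ?Y) = inverse c \<cdot>\<^sub>m (X * ?Y)" using c by (intro mult_smult_distrib)
    then show ?thesis unfolding XY using \<open>c \<noteq> 0\<close> \<open>d = c\<close> by (intro eq_matI) auto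
  qed
  moreover have "(inverse c \<cdot>\<^sub>m ?Y) * X = 1\<^sub>m m"
  proof -
    have "(inverse c \<cdot>\<^sub>m ?Y) * X = inverse c \<cdot>\<^sub>m (?Y * X)" using c by (intro mult_smult_assoc_mat)
    then show ?thesis unfolding YX using \<open>c \<noteq> 0\<close> by (intro eq_matI) auto
  qed
  ultimately have "invertible_mat X"
    unfolding invertible_mat_def inverts_mat_def using c carrier_matD(1)[OF c(2)] \<open>m = n\<close>
    by (intro conjI exI[of _ "inverse c \<cdot>\<^sub>m ?Y"]) auto
  with neq X show False by (auto simp: equivalent_corep_def)
qed

section \<open>Orthogonality of coefficients from invariance of the Haar state\<close>

lemma haar_slice:
  assumes G: "compact_quantum_group G" and h: "haar_state G h"
    and u: "unitary_corep G u" and v: "unitary_corep G v"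
    and ki: "k < dim_row u" "i < dim_row u" and lj: "l < dim_row v" "j < dim_row v"
  shows "h (star (u $$ (k, i)) * v $$ (l, j)) *\<^sub>C 1
    = (\<Sum>p<dim_row u. \<Sum>q<dim_row v. h (star (u $$ (k, p)) * v $$ (l, q)) *\<^sub>C (star (u $$ (p, i)) * v $$ (q, j)))"
proof -
  obtain K where K: "tensor_extension (tens G) (\<lambda>x y. h x *\<^sub>C y) K" and Kh: "\<And>x. K (comult G x) = h x *\<^sub>C 1"
    using h unfolding haar_state_def by blast
  have lin: "linear K" and KT: "\<And>a b. K (tens G a b) = h a *\<^sub>C b"
    using K bounded_linear.linear by (auto simp: tensor_extension_def bounded_clinear_def)
  have T: "tens G a b * tens G c d = tens G (a * c) (b * d)" "star (tens G a b) = tens G (star a) (star b)" for a b c d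
    using G by (auto simp: compact_quantum_group_def minimal_tensor_product_def)
  \<comment> \<open>The slice map \<open>K\<close> turns the comultiplication of this element into
    its Haar value times 1, so expanding the comultiplication yields the claim.\<close>
  have "comult G (star (u $$ (k, i)) * v $$ (l, j)) = star (comult G (u $$ (k, i))) * comult G (v $$ (l, j))"
    using G by (simp add: compact_quantum_group_def)
  also have "\<dots> = (\<Sum>p<dim_row u. \<Sum>q<dim_row v. tens G (star (u $$ (k, p)) * v $$ (l, q)) (star (u $$ (p, i)) * v $$ (q, j)))"
    by (simp add: comult_coeff[OF u ki] comult_coeff[OF v lj] star_sum sum_product T)
  finally have "K (comult G (star (u $$ (k, i)) * v $$ (l, j)))
    = (\<Sum>p<dim_row u. \<Sum>q<dim_row v. h (star (u $$ (k, p)) * v $$ (l, q)) *\<^sub>C (star (u $$ (p, i)) * v $$ (q, j)))"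
    by (simp add: linear_sum[OF lin] KT)
  then show ?thesis by (simp add: Kh)
qed

text \<open>This is the averaging argument applied to the matrix unit at \<open>(k, l)\<close>. By
  \<open>haar_slice\<close>, \<open>?X\<close> as a matrix of scalars equals the adjoint of
  \<open>u\<close> times \<open>?X\<close> times \<open>v\<close>; multiplying by \<open>u\<close>
  on the left gives the intertwining relation.\<close>

lemma haar_intertwiner:
  assumes G: "compact_quantum_group G" and h: "haar_state G h"
    and u: "unitary_corep G u" and v: "unitary_corep G v" and k: "k < dim_row u" and l: "l < dim_row v"
  shows "intertwiner v u (mat (dim_row u) (dim_row v) (\<lambda>(i, j). h (star (u $$ (k, i)) * v $$ (l, j))))"
    (is "intertwiner v u ?X")
proof -
  let ?m = "dim_row u" and ?n = "dim_row v"
  note dims = unitary_corep_dim[OF u] unitary_corep_dim[OF v]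
  have "scalar_mat ?X * v = u * scalar_mat ?X"
  proof (rule eq_matI)
    fix a j assume "a < dim_row (u * scalar_mat ?X)" "j < dim_col (u * scalar_mat ?X)"
    then have aj: "a < ?m" "j < ?n" by auto
    have "(u * scalar_mat ?X) $$ (a, j) = (\<Sum>i<?m. u $$ (a, i) * (h (star (u $$ (k, i)) * v $$ (l, j)) *\<^sub>C 1))"
      using aj dims by (simp add: scalar_prod_def atLeast0LessThan)
    also have "\<dots> = (\<Sum>i<?m. \<Sum>p<?m. \<Sum>q<?n.
        h (star (u $$ (k, p)) * v $$ (l, q)) *\<^sub>C (u $$ (a, i) * (star (u $$ (p, i)) * v $$ (q, j))))"
      using aj by (simp add: haar_slice[OF G h u v k _ l] sum_distrib_left mult_scaleC_right)
    also have "\<dots> = (\<Sum>p<?m. \<Sum>q<?n. \<Sum>i<?m.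
        h (star (u $$ (k, p)) * v $$ (l, q)) *\<^sub>C (u $$ (a, i) * (star (u $$ (p, i)) * v $$ (q, j))))"
      \<comment> \<open>The sum over \<open>i\<close> moves innermost, where \<open>u\<close> meets
        its adjoint and collapses to a Kronecker delta.\<close>
      by (subst sum.swap, rule sum.cong[OF refl], rule sum.swap)
    also have "\<dots> = (\<Sum>p<?m. \<Sum>q<?n.
        h (star (u $$ (k, p)) * v $$ (l, q)) *\<^sub>C ((\<Sum>i<?m. u $$ (a, i) * star (u $$ (p, i))) * v $$ (q, j)))"
      by (simp add: complex_vector.scale_sum_right sum_distrib_right mult.assoc)
    also have "\<dots> = (\<Sum>p<?m. if a = p then \<Sum>q<?n. h (star (u $$ (k, p)) * v $$ (l, q)) *\<^sub>C v $$ (q, j) else 0)"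
      using aj by (intro sum.cong) (auto simp: unitary_corep_mult_star[OF u])
    also have "\<dots> = (\<Sum>q<?n. h (star (u $$ (k, a)) * v $$ (l, q)) *\<^sub>C v $$ (q, j))"
      using aj by simp
    also have "\<dots> = (scalar_mat ?X * v) $$ (a, j)"
      using aj dims by (simp add: scalar_prod_def atLeast0LessThan mult_scaleC_left)
    finally show "(scalar_mat ?X * v) $$ (a, j) = (u * scalar_mat ?X) $$ (a, j)" by simp
  qed (use dims in auto)
  then show ?thesis
    unfolding intertwiner_def by (intro conjI mat_carrier)
qed

lemma haar_orthogonal_inequivalent:
  assumes G: "compact_quantum_group G" and h: "haar_state G h"
    and u: "irreducible_corep G u" and v: "irreducible_corep G v" and neq: "\<not> equivalent_corep v u"
    and ki: "k < dim_row u" "i < dim_row u" and lj: "l < dim_row v" "j < dim_row v"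
  shows "h (star (u $$ (k, i)) * v $$ (l, j)) = 0"
proof -
  have "unitary_corep G u" "unitary_corep G v" using u v by (simp_all add: irreducible_corep_def)
  from schur_inequivalent[OF v u neq haar_intertwiner[OF G h this ki(1) lj(1)]]
  have "mat (dim_row u) (dim_row v) (\<lambda>(i, j). h (star (u $$ (k, i)) * v $$ (l, j))) $$ (i, j)
      = 0\<^sub>m (dim_row u) (dim_row v) $$ (i, j)"
    by simp
  then show ?thesis using ki lj by simp
qed

text \<open>For fixed \<open>k\<close> and \<open>l\<close> the matrix of Haar values is a
  self-intertwiner, hence a scalar \<open>c\<close>. Its trace determines \<open>c\<close>: the Kac
  assumption allows the two factors to be exchanged under \<open>h\<close>, after which unitarity
  evaluates the sum.\<close>

lemma haar_orthogonal:
  assumes G: "compact_quantum_group G" and h: "haar_state G h" and tr: "tracial h"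
    and u: "irreducible_corep G u"
    and ki: "k < dim_row u" "i < dim_row u" and lj: "l < dim_row u" "j < dim_row u"
  shows "h (star (u $$ (k, i)) * u $$ (l, j)) = (if k = l \<and> i = j then 1 / of_nat (dim_row u) else 0)"
proof -
  let ?m = "dim_row u"
  have uu: "unitary_corep G u" using u by (simp add: irreducible_corep_def)
  have hlin: "clinear_on UNIV h" and h1: "h 1 = 1"
    using h by (auto simp: haar_state_def state_on_def)
  obtain c where "mat ?m ?m (\<lambda>(i, j). h (star (u $$ (k, i)) * u $$ (l, j))) = c \<cdot>\<^sub>m 1\<^sub>m ?m"
    using u haar_intertwiner[OF G h uu uu ki(1) lj(1)] unfolding irreducible_corep_def by blast
  then have X: "mat ?m ?m (\<lambda>(i, j). h (star (u $$ (k, i)) * u $$ (l, j))) $$ (i, j) = (c \<cdot>\<^sub>m 1\<^sub>m ?m) $$ (i, j)" for i j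
    by simp
  have c: "h (star (u $$ (k, i)) * u $$ (l, j)) = (if i = j then c else 0)" if "i < ?m" "j < ?m" for i j
    using X[of i j] that by simp
  have "of_nat ?m * c = (\<Sum>i<?m. h (star (u $$ (k, i)) * u $$ (l, i)))"
    by (simp add: c)
  also have "\<dots> = (\<Sum>i<?m. h (u $$ (l, i) * star (u $$ (k, i))))"
    using tr by (simp add: tracial_def)
  also have "\<dots> = h (if l = k then 1 else 0)"
    using clinear_on_sum[OF hlin, of "{..<?m}" "\<lambda>i. u $$ (l, i) * star (u $$ (k, i))"]
    by (simp add: unitary_corep_mult_star[OF uu lj(1) ki(1)])
  also have "\<dots> = (if k = l then 1 else 0)"
    using h1 clinear_on_zero[OF hlin] by simp
  finally have "c = (if k = l then 1 / of_nat ?m else 0)"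
    using ki by (auto simp: field_simps split: if_splits)
  with c ki lj show ?thesis by simp
qed

text \<open>An invertible intertwiner \<open>X\<close> gives \<open>v = Y * (u * X)\<close> with
  scalar matrices, so each entry of \<open>v\<close> is a linear combination of entries of
  \<open>u\<close>.\<close>

lemma coeff_space_equivalent:
  fixes u v :: "'a::cstar_algebra mat"
  assumes v: "unitary_corep G v" and u: "unitary_corep G u" and eq: "equivalent_corep v u"
    and ij: "i < dim_row v" "j < dim_row v"
  shows "v $$ (i, j) \<in> coeff_space u"
proof -
  obtain X where X: "intertwiner v u X" "invertible_mat X" using eq by (auto simp: equivalent_corep_def)
  then obtain Y where Y: "X * Y = 1\<^sub>m (dim_row X)" "Y * X = 1\<^sub>m (dim_row Y)"
    by (auto simp: invertible_mat_def inverts_mat_def)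
  obtain n where n: "n = dim_row v" and vc: "v \<in> carrier_mat n n"
    using unitary_corep_dim[OF v] unitary_corep_carrier[OF v] by blast
  have "X \<in> carrier_mat (dim_row u) n" using X(1) unfolding n intertwiner_def by blast
  then have dim: "dim_row u = n" and Xc: "X \<in> carrier_mat n n"
    using X(2) by (auto simp: invertible_mat_def)
  have uc: "u \<in> carrier_mat n n"
    using dim unitary_corep_dim[OF u] by (intro carrier_matI) auto
  have Yc: "Y \<in> carrier_mat n n"
    using arg_cong[OF Y(1), of dim_col] arg_cong[OF Y(2), of dim_col] Xc by (intro carrier_matI) auto
  let ?X = "scalar_mat X :: 'a mat" and ?Y = "scalar_mat Y :: 'a mat"
  have c: "?X \<in> carrier_mat n n" "?Y \<in> carrier_mat n n"
    using Xc Yc by auto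
  have YX: "?Y * ?X = 1\<^sub>m n"
  proof -
    have "?Y * ?X = scalar_mat (Y * X)"
      using Xc Yc by (intro scalar_mat_mult[symmetric]) auto
    then show ?thesis using Y(2) Yc by simp
  qed
  have "v = ?Y * ?X * v" unfolding YX using vc by simp
  also have "\<dots> = ?Y * (?X * v)" using c vc by (intro assoc_mult_mat)
  also have "?X * v = u * ?X" using X(1) unfolding intertwiner_def by blast
  finally have v_eq: "v = ?Y * (u * ?X)" .
  have ij': "i < n" "j < n" using ij n by auto
  have "v $$ (i, j) = (?Y * (u * ?X)) $$ (i, j)"
    by (rule arg_cong[OF v_eq])
  also have "\<dots> = (\<Sum>p<n. \<Sum>q<n. (Y $$ (i, p) * X $$ (q, j)) *\<^sub>C u $$ (p, q))"
    using ij' c Xc Yc uc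
    by (simp add: scalar_prod_def atLeast0LessThan mult_scaleC_left mult_scaleC_right
        complex_vector.scale_sum_right scaleC_scaleC)
  also have "\<dots> \<in> coeff_space u"
    unfolding coeff_space_def
    by (intro complex_vector.span_sum complex_vector.span_scale complex_vector.span_base) (use dim in auto)
  finally show ?thesis .
qed

text \<open>One representative per equivalence class suffices, so inductions over
  \<open>Pol G\<close> can be restricted to generators on which the eigenvalues are known.\<close>

lemma Pol_enumeration:
  assumes "irrep_enumeration G u"
  shows "Pol G = cspan {u s $$ (i, j) |s i j. i < dim_row (u s) \<and> j < dim_row (u s)}" (is "_ = cspan ?S")
proof
  have irr: "irreducible_corep G (u s)" for s
    using assms by (simp add: irrep_enumeration_def)
  show "cspan ?S \<subseteq> Pol G"
    by (rule complex_vector.span_minimal) (auto simp: coeff_in_Pol[OF irr] subspace_Pol)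
  show "Pol G \<subseteq> cspan ?S"
    unfolding Pol_eq
  proof (rule complex_vector.span_minimal)
    show "{v $$ (i, j) |v i j. irreducible_corep G v \<and> i < dim_row v \<and> j < dim_row v} \<subseteq> cspan ?S"
    proof clarify
      fix v i j assume v: "irreducible_corep G v" "i < dim_row v" "j < dim_row v"
      then obtain s where "equivalent_corep v (u s)"
        using assms unfolding irrep_enumeration_def by blast
      then have "v $$ (i, j) \<in> coeff_space (u s)"
        using v irr[of s] by (intro coeff_space_equivalent[of G]) (auto simp: irreducible_corep_def)
      moreover have "coeff_space (u s) \<subseteq> cspan ?S"
        unfolding coeff_space_def by (rule complex_vector.span_mono) blast
      ultimately show "v $$ (i, j) \<in> cspan ?S" by blast
    qed
  qed simp
qed

subsection \<open>Spectral projections and the smoothing estimate\<close>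

lemma cinner_add_left: "cinner (x + y) (z::'h::complex_hilbert) = cinner x z + cinner y z"
  by (metis cinner_add_right cinner_commute complex_cnj_add)

lemma cinner_scaleC_left: "cinner (a *\<^sub>C x) (y::'h::complex_hilbert) = cnj a * cinner x y"
  by (metis cinner_scaleC_right cinner_commute complex_cnj_mult)

lemma cinner_zero_right [simp]: "cinner x (0::'h::complex_hilbert) = 0"
  using cinner_scaleC_right[of x 0 0] by simp

lemma cinner_zero_left [simp]: "cinner (0::'h::complex_hilbert) x = 0"
  using cinner_scaleC_left[of 0 0 x] by simp

lemma cinner_sum_right: "cinner x (\<Sum>i\<in>I. f i) = (\<Sum>i\<in>I. cinner x (f i :: 'h::complex_hilbert))"
  by (induction I rule: infinite_finite_induct) (auto simp: cinner_add_right)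

lemma cinner_sum_left: "cinner (\<Sum>i\<in>I. f i) x = (\<Sum>i\<in>I. cinner (f i) (x :: 'h::complex_hilbert))"
  by (induction I rule: infinite_finite_induct) (auto simp: cinner_add_left)

lemma cinner_diff_right: "cinner x (y - z) = cinner x y - cinner x (z::'h::complex_hilbert)"
  using cinner_add_right[of x "y - z" z] by simp

lemma cinner_diff_left: "cinner (x - y) z = cinner x z - cinner y (z::'h::complex_hilbert)"
  using cinner_add_left[of "x - y" y z] by simp

text \<open>The hypothesis is what orthogonal projections of \<xi> onto mutually orthogonal
  subspaces satisfy. It makes the squared norm of \<xi> minus their sum equal to the difference of
  the two sides.\<close>

lemma bessel_inequality:
  fixes p :: "'i \<Rightarrow> 'h::complex_hilbert"
  assumes I: "finite I" and orth: "\<And>i j. i \<in> I \<Longrightarrow> j \<in> I \<Longrightarrow> cinner (p i) (p j) = (if i = j then cinner (p i) \<xi> else 0)"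
  shows "(\<Sum>i\<in>I. (norm (p i))\<^sup>2) \<le> (norm \<xi>)\<^sup>2"
proof -
  define q where "q = (\<Sum>i\<in>I. p i)"
  define R where "R = (\<Sum>i\<in>I. (norm (p i))\<^sup>2)"
  have pp: "cinner (p i) \<xi> = of_real ((norm (p i))\<^sup>2)" if "i \<in> I" for i
    using orth[OF that that] by (simp add: cinner_norm)
  have q\<xi>: "cinner q \<xi> = of_real R"
    by (simp add: q_def R_def cinner_sum_left pp)
  then have \<xi>q: "cinner \<xi> q = of_real R"
    by (subst cinner_commute) simp
  have qq: "cinner q q = of_real R"
    unfolding q_def R_def using I by (simp add: cinner_sum_left cinner_sum_right orth pp)
  have "complex_of_real ((norm (\<xi> - q))\<^sup>2) = of_real ((norm \<xi>)\<^sup>2 - R)"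
    using q\<xi> \<xi>q qq by (simp add: cinner_norm[symmetric] cinner_diff_left cinner_diff_right del: of_real_power)
  then have "(norm (\<xi> - q))\<^sup>2 = (norm \<xi>)\<^sup>2 - R" by (simp only: of_real_eq_iff)
  then show ?thesis using zero_le_power2[of "norm (\<xi> - q)"] by (simp add: R_def)
qed

lemma bounded_linear_scaleC: "bounded_linear (\<lambda>x::'h::complex_normed_vector. c *\<^sub>C x)"
  by (rule bounded_linear_intro[of _ "cmod c"])
    (simp_all add: scaleC_add_right scaleR_scaleC scaleC_scaleC mult.commute norm_scaleC)

lemma bounded_clinear_scaleR:
  assumes "bounded_clinear f"
  shows "bounded_clinear (\<lambda>x. r *\<^sub>R f x)"
  using assms
  by (auto simp: bounded_clinear_def scaleR_scaleC scaleC_scaleC mult.commute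
      intro: bounded_linear_compose[OF bounded_linear_scaleC])

text \<open>\<open>F x\<close> is the closed form of the full series of
  \<open>q ^ s * (\<beta> * s + x)^2\<close>. Splitting off the first term and shifting the index
  suggests \<open>rec\<close>, which is checked by algebra; iterating it \<open>N\<close> times
  leaves the nonnegative remainder \<open>q ^ N * F (\<beta> * N + \<gamma>)\<close>.\<close>

lemma weighted_square_sum_le:
  fixes q \<beta> \<gamma> :: real
  assumes q: "0 \<le> q" "q < 1" and "\<beta> \<ge> 0" "\<gamma> \<ge> 0"
  shows "(\<Sum>s<N. q ^ s * (\<beta> * real s + \<gamma>)\<^sup>2)
    \<le> (\<beta>\<^sup>2 * q * (1 + q) + 2 * \<beta> * \<gamma> * q * (1 - q) + \<gamma>\<^sup>2 * (1 - q)\<^sup>2) / (1 - q) ^ 3"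
proof -
  define F where "F x = (\<beta>\<^sup>2 * q * (1 + q) + 2 * \<beta> * x * q * (1 - q) + x\<^sup>2 * (1 - q)\<^sup>2) / (1 - q) ^ 3" for x
  have rec: "F x = x\<^sup>2 + q * F (\<beta> + x)" for x
  proof -
    have "\<beta>\<^sup>2 * q * (1 + q) + 2 * \<beta> * x * q * (1 - q) + x\<^sup>2 * (1 - q)\<^sup>2
      = x\<^sup>2 * (1 - q) ^ 3 + q * (\<beta>\<^sup>2 * q * (1 + q) + 2 * \<beta> * (\<beta> + x) * q * (1 - q) + (\<beta> + x)\<^sup>2 * (1 - q)\<^sup>2)"
      by (simp add: power2_eq_square power3_eq_cube algebra_simps)
    moreover have "x\<^sup>2 + q * (B / (1 - q) ^ 3) = (x\<^sup>2 * (1 - q) ^ 3 + q * B) / (1 - q) ^ 3" for B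
      using q by (simp add: add_divide_distrib)
    ultimately show ?thesis by (simp only: F_def)
  qed
  have "(\<Sum>s<N. q ^ s * (\<beta> * real s + \<gamma>)\<^sup>2) + q ^ N * F (\<beta> * real N + \<gamma>) = F \<gamma>"
  proof (induction N)
    case (Suc N)
    have "F (\<beta> * real N + \<gamma>) = (\<beta> * real N + \<gamma>)\<^sup>2 + q * F (\<beta> * real (Suc N) + \<gamma>)"
      using rec[of "\<beta> * real N + \<gamma>"] by (simp add: algebra_simps)
    with Suc show ?case by (simp add: algebra_simps del: of_nat_Suc)
  qed simp
  moreover have "q ^ N * F (\<beta> * real N + \<gamma>) \<ge> 0"
    unfolding F_def using assms by (intro mult_nonneg_nonneg divide_nonneg_nonneg add_nonneg_nonneg) auto
  ultimately have "(\<Sum>s<N. q ^ s * (\<beta> * real s + \<gamma>)\<^sup>2) \<le> F \<gamma>" by linarith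
  then show ?thesis by (simp only: F_def)
qed

section \<open>Closure properties of the double commutant\<close>

lemma reduced_algebra_subset_Linf: "reduced_algebra G \<pi> \<subseteq> Linf G \<pi>"
  by (auto simp: Linf_def commutant_def reduced_algebra_def)

text \<open>A norm-convergent series converges pointwise, and a bounded operator \<open>R\<close>
  that commutes with every term commutes with the pointwise sum.\<close>

lemma Linf_suminf:
  fixes Y :: "nat \<Rightarrow> 'h::complex_hilbert \<Rightarrow>\<^sub>L 'h"
  assumes Y: "\<And>s. blinfun_apply (Y s) \<in> Linf G \<pi>" and summable: "summable Y"
  shows "blinfun_apply (suminf Y) \<in> Linf G \<pi>"
proof -
  have apply_suminf: "suminf Y \<xi> = (\<Sum>s. Y s \<xi>)" "summable (\<lambda>s. Y s \<xi>)" for \<xi>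
    using bounded_linear.suminf[OF blinfun.bounded_linear_left summable, of \<xi>]
      bounded_linear.summable[OF blinfun.bounded_linear_left summable, of \<xi>] by simp_all
  have Ylin: "Y s (c *\<^sub>C \<xi>) = c *\<^sub>C Y s \<xi>" for s c \<xi>
    using Y[of s] by (simp add: Linf_def commutant_def bounded_clinear_def)
  have "suminf Y (c *\<^sub>C \<xi>) = c *\<^sub>C suminf Y \<xi>" for c \<xi>
    using bounded_linear.suminf[OF bounded_linear_scaleC apply_suminf(2)]
    by (simp add: apply_suminf(1) Ylin)
  then have "bounded_clinear (blinfun_apply (suminf Y))"
    by (simp add: bounded_clinear_def blinfun.bounded_linear_right)
  moreover have "suminf Y (R \<xi>) = R (suminf Y \<xi>)" if R: "R \<in> commutant (reduced_algebra G \<pi>)" for R \<xi>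
  proof -
    have "bounded_linear R" using R by (simp add: commutant_def bounded_clinear_def)
    from bounded_linear.suminf[OF this apply_suminf(2)]
    have "R (suminf Y \<xi>) = (\<Sum>s. R (Y s \<xi>))" by (simp add: apply_suminf(1))
    moreover have "R (Y s \<xi>) = Y s (R \<xi>)" for s
      using Y[of s] R by (simp add: Linf_def commutant_def[of "commutant _"] fun_eq_iff)
    ultimately show ?thesis by (simp add: apply_suminf(1))
  qed
  ultimately show ?thesis
    by (auto simp: Linf_def commutant_def[of "commutant _"])
qed

lemma Linf_scaleR:
  assumes "y \<in> Linf G \<pi>"
  shows "(\<lambda>\<xi>. r *\<^sub>R y \<xi>) \<in> Linf G \<pi>"
proof -
  have "R (r *\<^sub>R \<xi>) = r *\<^sub>R R \<xi>" if "R \<in> commutant (reduced_algebra G \<pi>)" for R \<xi>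
    using that by (auto simp: commutant_def bounded_clinear_def intro: linear_scale bounded_linear.linear)
  then show ?thesis
    using assms
    by (auto simp: Linf_def commutant_def[of "commutant _"] fun_eq_iff intro: bounded_clinear_scaleR)
qed

section \<open>Components of Hilbert space vectors in the coefficient spaces\<close>

locale enumerated_gns =
  fixes G :: "('a::cstar_algebra, 'b::cstar_algebra, 'c::cstar_algebra) quantum_group"
    and h :: "'a \<Rightarrow> complex"
    and \<Lambda> :: "'a \<Rightarrow> 'h::complex_hilbert"
    and \<pi> :: "'a \<Rightarrow> 'h \<Rightarrow> 'h"
    and u :: "nat \<Rightarrow> 'a mat"
  assumes cqg: "compact_quantum_group G"
    and haar: "haar_state G h"
    and tracial: "tracial h"
    and gns: "gns_construction (Pol G) h \<Lambda> \<pi>"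
    and enum: "irrep_enumeration G u"
begin

abbreviation deg :: "nat \<Rightarrow> nat" where "deg s \<equiv> dim_row (u s)"

text \<open>The vectors of the coefficients have squared norm \<open>1 / deg s\<close>, so the
  factor \<open>deg s\<close> normalizes the Fourier expansion. The component is an algebra element,
  not a vector, so that \<pi> can be applied to it; \<open>proj s\<close> is the corresponding
  projection.\<close>

definition component :: "nat \<Rightarrow> 'h \<Rightarrow> 'a" where
  "component s \<xi> = (\<Sum>i<deg s. \<Sum>j<deg s. (of_nat (deg s) * cinner (\<Lambda> (u s $$ (i, j))) \<xi>) *\<^sub>C u s $$ (i, j))"

abbreviation proj :: "nat \<Rightarrow> 'h \<Rightarrow> 'h" where
  "proj s \<xi> \<equiv> \<Lambda> (component s \<xi>)"

lemma irr: "irreducible_corep G (u s)"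
  using enum by (simp add: irrep_enumeration_def)

lemma inequivalent: "s \<noteq> r \<Longrightarrow> \<not> equivalent_corep (u s) (u r)"
  using enum by (auto simp: irrep_enumeration_def)

lemma deg_pos: "deg s > 0"
  using irr[of s] by (simp add: irreducible_corep_def)

lemma u_Pol: "i < deg s \<Longrightarrow> j < deg s \<Longrightarrow> u s $$ (i, j) \<in> Pol G"
  by (rule coeff_in_Pol[OF irr])

lemma \<Lambda>_clinear: "clinear_on (Pol G) \<Lambda>"
  using gns by (simp add: gns_construction_def)

lemma \<Lambda>_cinner: "x \<in> Pol G \<Longrightarrow> y \<in> Pol G \<Longrightarrow> cinner (\<Lambda> x) (\<Lambda> y) = h (star x * y)"
  using gns by (simp add: gns_construction_def)

lemma \<Lambda>_dense: "closure (\<Lambda> ` Pol G) = UNIV"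
  using gns by (simp add: gns_construction_def)

lemma \<pi>_bounded: "x \<in> Pol G \<Longrightarrow> bounded_clinear (\<pi> x)"
  using gns by (simp add: gns_construction_def)

lemma \<pi>_one: "x \<in> Pol G \<Longrightarrow> \<pi> x (\<Lambda> 1) = \<Lambda> x"
  using gns one_in_Pol[OF cqg] by (simp add: gns_construction_def)

lemma norm_\<Lambda>: "x \<in> Pol G \<Longrightarrow> norm (\<Lambda> x) = L2_norm h x"
  by (simp add: L2_norm_def cinner_norm flip: \<Lambda>_cinner of_real_power)

lemma coeff_space_Pol: "coeff_space (u s) \<subseteq> Pol G"
  unfolding coeff_space_def by (rule complex_vector.span_minimal) (auto simp: u_Pol subspace_Pol)

lemma component_in_coeff_space: "component s \<xi> \<in> coeff_space (u s)"
  unfolding component_def coeff_space_def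
  by (intro complex_vector.span_sum complex_vector.span_scale complex_vector.span_base) auto

lemma component_Pol: "component s \<xi> \<in> Pol G"
  using component_in_coeff_space coeff_space_Pol by blast

lemma proj_eq: "proj s \<xi> = (\<Sum>i<deg s. \<Sum>j<deg s. (of_nat (deg s) * cinner (\<Lambda> (u s $$ (i, j))) \<xi>) *\<^sub>C \<Lambda> (u s $$ (i, j)))"
proof -
  note scale = complex_vector.subspace_scale[OF subspace_Pol u_Pol]
  have "proj s \<xi> = (\<Sum>i<deg s. \<Lambda> (\<Sum>j<deg s. (of_nat (deg s) * cinner (\<Lambda> (u s $$ (i, j))) \<xi>) *\<^sub>C u s $$ (i, j)))"
    unfolding component_def
    by (intro clinear_on_sum[OF \<Lambda>_clinear subspace_Pol] complex_vector.subspace_sum[OF subspace_Pol] scale) auto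
  also have "\<dots> = (\<Sum>i<deg s. \<Sum>j<deg s. \<Lambda> ((of_nat (deg s) * cinner (\<Lambda> (u s $$ (i, j))) \<xi>) *\<^sub>C u s $$ (i, j)))"
    by (intro sum.cong refl clinear_on_sum[OF \<Lambda>_clinear subspace_Pol] scale) auto
  also have "\<dots> = (\<Sum>i<deg s. \<Sum>j<deg s. (of_nat (deg s) * cinner (\<Lambda> (u s $$ (i, j))) \<xi>) *\<^sub>C \<Lambda> (u s $$ (i, j)))"
    by (intro sum.cong refl clinear_on_scaleC[OF \<Lambda>_clinear] u_Pol) auto
  finally show ?thesis .
qed

lemma proj_add: "proj s (\<xi> + \<eta>) = proj s \<xi> + proj s \<eta>"
  by (simp add: proj_eq cinner_add_right distrib_left scaleC_add_left sum.distrib)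

lemma proj_scaleC: "proj s (c *\<^sub>C \<xi>) = c *\<^sub>C proj s \<xi>"
  by (simp add: proj_eq cinner_scaleC_right complex_vector.scale_sum_right scaleC_scaleC mult_ac)

lemma cinner_coeff:
  assumes "k < deg s" "i < deg s" "l < deg r" "j < deg r"
  shows "cinner (\<Lambda> (u s $$ (k, i))) (\<Lambda> (u r $$ (l, j)))
    = (if s = r \<and> k = l \<and> i = j then 1 / of_nat (deg s) else 0)"
  using assms haar_orthogonal_inequivalent[OF cqg haar irr[of s] irr[of r] inequivalent]
    haar_orthogonal[OF cqg haar tracial irr[of s]]
  by (cases "s = r") (auto simp: \<Lambda>_cinner u_Pol)

text \<open>The weight \<open>deg r\<close> cancels the \<open>1 / deg s\<close> of the
  orthogonality relations when \<open>s = r\<close>. Thus \<open>proj r\<close> preserves inner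
  products with its own coefficient vectors and is orthogonal to the others.\<close>

lemma cinner_coeff_proj:
  assumes "k < deg s" "i < deg s"
  shows "cinner (\<Lambda> (u s $$ (k, i))) (proj r \<xi>) = (if s = r then cinner (\<Lambda> (u s $$ (k, i))) \<xi> else 0)"
proof -
  have "cinner (\<Lambda> (u s $$ (k, i))) (proj r \<xi>)
    = (\<Sum>l<deg r. \<Sum>j<deg r. of_nat (deg r) * cinner (\<Lambda> (u r $$ (l, j))) \<xi> *
        (if s = r \<and> k = l \<and> i = j then 1 / of_nat (deg s) else 0))"
    unfolding proj_eq cinner_sum_right cinner_scaleC_right
    by (intro sum.cong refl) (simp add: cinner_coeff assms)
  \<comment> \<open>Nesting the conditions lets each sum collapse separately by the rule for a
    Kronecker delta.\<close>
  also have "\<dots> = (\<Sum>l<deg r. \<Sum>j<deg r. if k = l then if i = j then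
      (if s = r then cinner (\<Lambda> (u s $$ (l, j))) \<xi> else 0) else 0 else 0)"
    using deg_pos[of r] by (intro sum.cong refl) auto
  also have "\<dots> = (\<Sum>l<deg r. if k = l then \<Sum>j<deg r. if i = j then
      (if s = r then cinner (\<Lambda> (u s $$ (l, j))) \<xi> else 0) else 0 else 0)"
    by (intro sum.cong refl) auto
  also have "\<dots> = (if s = r then cinner (\<Lambda> (u s $$ (k, i))) \<xi> else 0)"
    using assms by auto
  finally show ?thesis .
qed

lemma cinner_proj_proj: "cinner (proj s \<xi>) (proj r \<eta>) = (if s = r then cinner (proj s \<xi>) \<eta> else 0)"
  unfolding proj_eq[of s] cinner_sum_left cinner_scaleC_left
  by (auto simp: cinner_coeff_proj)

lemma proj_coeff:
  assumes "i < deg s" "j < deg s"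
  shows "proj r (\<Lambda> (u s $$ (i, j))) = (if r = s then \<Lambda> (u s $$ (i, j)) else 0)"
proof -
  have "proj r (\<Lambda> (u s $$ (i, j))) = (\<Sum>k<deg r. \<Sum>l<deg r. if k = i then if l = j then
      (if r = s then \<Lambda> (u s $$ (k, l)) else 0) else 0 else 0)"
    unfolding proj_eq using assms deg_pos[of s]
    by (intro sum.cong refl) (auto simp: cinner_coeff)
  also have "\<dots> = (\<Sum>k<deg r. if k = i then \<Sum>l<deg r. if l = j then
      (if r = s then \<Lambda> (u s $$ (k, l)) else 0) else 0 else 0)"
    by (intro sum.cong refl) auto
  also have "\<dots> = (if r = s then \<Lambda> (u s $$ (i, j)) else 0)"
    using assms by auto
  finally show ?thesis .
qed

lemma proj_bessel: "(\<Sum>s<N. (norm (proj s \<xi>))\<^sup>2) \<le> (norm \<xi>)\<^sup>2"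
  by (rule bessel_inequality) (auto simp: cinner_proj_proj)

lemma norm_proj_le: "norm (proj s \<xi>) \<le> norm \<xi>"
proof (rule power2_le_imp_le)
  have "(norm (proj s \<xi>))\<^sup>2 \<le> (\<Sum>s<Suc s. (norm (proj s \<xi>))\<^sup>2)"
    by (rule member_le_sum) auto
  also note proj_bessel
  finally show "(norm (proj s \<xi>))\<^sup>2 \<le> (norm \<xi>)\<^sup>2" .
qed simp

lemma \<pi>_Linf: "x \<in> Pol G \<Longrightarrow> \<pi> x \<in> Linf G \<pi>"
  using reduced_algebra_subset_Linf[of G \<pi>] \<pi>_bounded[of x]
  by (force simp: reduced_algebra_def onorm_zero)

text \<open>Each component map is a contraction by Bessel, so absolute summability of
  \<open>c\<close> dominates the series at every vector.\<close>

lemma multiplier_bounded_clinear: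
  assumes c: "summable (\<lambda>s. \<bar>c s\<bar>)"
  shows "bounded_clinear (\<lambda>\<xi>. \<Sum>s. c s *\<^sub>R proj s \<xi>)"
    and "summable (\<lambda>s. c s *\<^sub>R proj s \<xi>)"
proof -
  have bound: "norm (c s *\<^sub>R proj s \<xi>) \<le> \<bar>c s\<bar> * norm \<xi>" for s \<xi>
    by (simp add: mult_left_mono norm_proj_le)
  have sn: "summable (\<lambda>s. norm (c s *\<^sub>R proj s \<xi>))" for \<xi>
    by (rule summable_comparison_test'[OF summable_mult2[OF c, of "norm \<xi>"], of 0]) (use bound in auto)
  then show summable: "summable (\<lambda>s. c s *\<^sub>R proj s \<xi>)" for \<xi>
    by (rule summable_norm_cancel)
  have add: "(\<Sum>s. c s *\<^sub>R proj s (\<xi> + \<eta>)) = (\<Sum>s. c s *\<^sub>R proj s \<xi>) + (\<Sum>s. c s *\<^sub>R proj s \<eta>)" for \<xi> \<eta>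
    by (simp add: proj_add scaleR_add_right suminf_add[OF summable summable])
  have scale: "(\<Sum>s. c s *\<^sub>R proj s (a *\<^sub>C \<xi>)) = a *\<^sub>C (\<Sum>s. c s *\<^sub>R proj s \<xi>)" for a \<xi>
    unfolding bounded_linear.suminf[OF bounded_linear_scaleC summable]
    by (simp add: proj_scaleC scaleR_scaleC scaleC_scaleC mult.commute)
  have "bounded_linear (\<lambda>\<xi>. \<Sum>s. c s *\<^sub>R proj s \<xi>)"
  proof (rule bounded_linear_intro)
    fix r \<xi>
    show "(\<Sum>s. c s *\<^sub>R proj s (r *\<^sub>R \<xi>)) = r *\<^sub>R (\<Sum>s. c s *\<^sub>R proj s \<xi>)"
      using scale[of "of_real r" \<xi>] by (simp only: scaleR_scaleC)
    have "norm (\<Sum>s. c s *\<^sub>R proj s \<xi>) \<le> (\<Sum>s. norm (c s *\<^sub>R proj s \<xi>))"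
      by (rule summable_norm[OF sn])
    also have "\<dots> \<le> (\<Sum>s. \<bar>c s\<bar> * norm \<xi>)"
      by (rule suminf_le[OF bound sn summable_mult2[OF c]])
    also have "\<dots> = norm \<xi> * (\<Sum>s. \<bar>c s\<bar>)"
      by (simp add: suminf_mult[OF c] mult.commute)
    finally show "norm (\<Sum>s. c s *\<^sub>R proj s \<xi>) \<le> norm \<xi> * (\<Sum>s. \<bar>c s\<bar>)" .
  qed (rule add)
  with scale show "bounded_clinear (\<lambda>\<xi>. \<Sum>s. c s *\<^sub>R proj s \<xi>)"
    by (simp add: bounded_clinear_def)
qed

text \<open>The multiplier agrees with \<open>T\<close> on the coefficients, hence on
  \<open>Pol G\<close> by linearity. Uniqueness, required by the definite description, follows from
  continuity and density of the image of \<Lambda>.\<close>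

lemma L2_extension_eq:
  assumes c: "summable (\<lambda>s. \<bar>c s\<bar>)" and T: "clinear_on (Pol G) T"
    and eig: "\<And>s i j. i < deg s \<Longrightarrow> j < deg s \<Longrightarrow> T (u s $$ (i, j)) = c s *\<^sub>R u s $$ (i, j)"
  shows "L2_extension G \<Lambda> T = (\<lambda>\<xi>. \<Sum>s. c s *\<^sub>R proj s \<xi>)" (is "_ = ?S")
  unfolding L2_extension_def
proof (rule the_equality)
  note S = multiplier_bounded_clinear[OF c]
  have S_add: "?S (\<xi> + \<eta>) = ?S \<xi> + ?S \<eta>" and S_scale: "?S (a *\<^sub>C \<xi>) = a *\<^sub>C ?S \<xi>" for \<xi> \<eta> a
    using S(1) linear_add[of ?S] by (auto simp only: bounded_clinear_def dest: bounded_linear.linear)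
  \<comment> \<open>Membership of \<open>x\<close> and \<open>T x\<close> in \<open>Pol G\<close> is
    part of the induction because \<open>T\<close> and \<Lambda> are linear only there.\<close>
  have "x \<in> Pol G \<and> T x \<in> Pol G \<and> ?S (\<Lambda> x) = \<Lambda> (T x)" if "x \<in> Pol G" for x
    using that unfolding Pol_enumeration[OF enum]
  proof (induction rule: complex_vector.span_induct_alt)
    case base
    have "?S 0 = 0" using S_scale[of 0 0] by simp
    then show ?case
      using complex_vector.subspace_0[OF subspace_Pol, of G]
      by (simp add: clinear_on_zero[OF T] clinear_on_zero[OF \<Lambda>_clinear] flip: Pol_enumeration[OF enum])
  next
    case (step a x y)
    then obtain s i j where x: "x = u s $$ (i, j)" and ij: "i < deg s" "j < deg s" by blast
    have xP: "x \<in> Pol G" and Tx: "T x = of_real (c s) *\<^sub>C x"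
      using ij eig by (simp_all add: x u_Pol scaleR_scaleC)
    have "?S (\<Lambda> x) = (\<Sum>r. if r = s then c s *\<^sub>R \<Lambda> x else 0)"
      unfolding x by (intro suminf_cong) (simp add: proj_coeff ij)
    also have "\<dots> = c s *\<^sub>R \<Lambda> x"
      using sums_single[of s "\<lambda>_. c s *\<^sub>R \<Lambda> x"] by (simp add: sums_iff)
    finally have "?S (\<Lambda> x) = of_real (c s) *\<^sub>C \<Lambda> x" by (simp add: scaleR_scaleC)
    moreover have yP: "y \<in> Pol G" and TyP: "T y \<in> Pol G" and Sy: "?S (\<Lambda> y) = \<Lambda> (T y)"
      using step by (simp_all flip: Pol_enumeration[OF enum])
    moreover have "a *\<^sub>C x \<in> Pol G" "a *\<^sub>C of_real (c s) *\<^sub>C x \<in> Pol G" "of_real (c s) *\<^sub>C x \<in> Pol G"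
      using xP by (simp_all add: complex_vector.subspace_scale[OF subspace_Pol])
    ultimately show ?case
      unfolding Pol_enumeration[OF enum, symmetric] using xP
      by (simp add: S_add S_scale Tx complex_vector.subspace_add[OF subspace_Pol]
          clinear_on_add[OF T] clinear_on_scaleC[OF T] clinear_on_add[OF \<Lambda>_clinear] clinear_on_scaleC[OF \<Lambda>_clinear])
  qed
  then show S\<Lambda>: "bounded_clinear ?S \<and> (\<forall>x\<in>Pol G. ?S (\<Lambda> x) = \<Lambda> (T x))"
    using S(1) by blast
  fix S' assume S': "bounded_clinear S' \<and> (\<forall>x\<in>Pol G. S' (\<Lambda> x) = \<Lambda> (T x))"
  have "closed {\<xi>. S' \<xi> = ?S \<xi>}"
    using S' S\<Lambda> unfolding bounded_clinear_def
    by (intro closed_Collect_eq) (auto intro: linear_continuous_on)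
  moreover have "\<Lambda> ` Pol G \<subseteq> {\<xi>. S' \<xi> = ?S \<xi>}"
    using S' S\<Lambda> by auto
  ultimately have "closure (\<Lambda> ` Pol G) \<subseteq> {\<xi>. S' \<xi> = ?S \<xi>}" by (rule closure_minimal[rotated])
  then show "S' = ?S" unfolding \<Lambda>_dense by auto
qed

text \<open>The operator is built from left multiplications by the components of \<xi>. Pairing
  \<open>c s * w s\<close> with the norms of the components by Cauchy-Schwarz makes the series
  converge absolutely in operator norm with the stated bound.\<close>

lemma multiplier_Linf_norm_le:
  assumes c: "summable (\<lambda>s. \<bar>c s\<bar>)"
    and w: "\<And>s x. x \<in> coeff_space (u s) \<Longrightarrow> onorm (\<pi> x) \<le> w s * L2_norm h x"
    and f: "\<And>N. (\<Sum>s<N. (c s * w s)\<^sup>2) \<le> f"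
  shows "Linf_norm_le G \<Lambda> \<pi> (\<Sum>s. c s *\<^sub>R proj s \<xi>) (sqrt f * norm \<xi>)"
proof -
  \<comment> \<open>In the Banach space of bounded linear functions, absolute convergence gives an
    operator-norm limit.\<close>
  define Y where "Y s = c s *\<^sub>R Blinfun (\<pi> (component s \<xi>))" for s
  have bl: "bounded_linear (\<pi> (component s \<xi>))" for s
    using \<pi>_bounded[OF component_Pol] by (simp add: bounded_clinear_def)
  have Y_apply: "Y s \<eta> = c s *\<^sub>R \<pi> (component s \<xi>) \<eta>" for s \<eta>
    by (simp add: Y_def bounded_linear_Blinfun_apply[OF bl] scaleR_blinfun.rep_eq)
  have norm_Y: "norm (Y s) \<le> \<bar>c s * w s\<bar> * norm (proj s \<xi>)" for s
  proof -
    have "norm (Y s) = \<bar>c s\<bar> * onorm (\<pi> (component s \<xi>))"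
      using norm_blinfun.rep_eq[of "Blinfun (\<pi> (component s \<xi>))"]
      by (simp add: Y_def bounded_linear_Blinfun_apply[OF bl])
    also have "\<dots> \<le> \<bar>c s\<bar> * (w s * norm (proj s \<xi>))"
      using w[OF component_in_coeff_space, of s \<xi>] by (intro mult_left_mono) (simp_all add: norm_\<Lambda> component_Pol)
    also have "\<dots> \<le> \<bar>c s * w s\<bar> * norm (proj s \<xi>)"
      by (simp add: abs_mult mult_left_mono mult_right_mono mult.assoc)
    finally show ?thesis .
  qed
  have partial: "(\<Sum>s<N. norm (Y s)) \<le> sqrt f * norm \<xi>" for N
  proof -
    have "(\<Sum>s<N. norm (Y s)) \<le> (\<Sum>s<N. \<bar>c s * w s\<bar> * norm (proj s \<xi>))"
      by (intro sum_mono norm_Y)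
    also have "\<dots> \<le> sqrt ((\<Sum>s<N. (c s * w s)\<^sup>2) * (\<Sum>s<N. (norm (proj s \<xi>))\<^sup>2))"
      using Cauchy_Schwarz_ineq_sum[of "\<lambda>s. \<bar>c s * w s\<bar>" "\<lambda>s. norm (proj s \<xi>)" "{..<N}"]
      by (intro real_le_rsqrt) simp
    also have "\<dots> \<le> sqrt (f * (norm \<xi>)\<^sup>2)"
      \<comment> \<open>The instance at 0 has an empty sum and supplies nonnegativity of
        \<open>f\<close>.\<close>
      using f[of N] f[of 0] by (intro real_sqrt_le_mono mult_mono proj_bessel sum_nonneg) auto
    also have "\<dots> = sqrt f * norm \<xi>" by (simp add: real_sqrt_mult)
    finally show ?thesis .
  qed
  have sn: "summable (\<lambda>s. norm (Y s))"
    using partial by (rule summableI_nonneg_bounded[rotated]) simp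
  then have sY: "summable Y" by (rule summable_norm_cancel)
  show ?thesis
    unfolding Linf_norm_le_def
  proof (intro bexI conjI)
    \<comment> \<open>Applied to the cyclic vector, left multiplication by a component returns the
      vector of that component, so the operator represents the required element of the Hilbert
      space.\<close>
    show "suminf Y (\<Lambda> 1) = (\<Sum>s. c s *\<^sub>R proj s \<xi>)"
      using bounded_linear.suminf[OF blinfun.bounded_linear_left sY, of "\<Lambda> 1"]
      by (simp add: Y_apply \<pi>_one component_Pol)
    have "norm (suminf Y) \<le> (\<Sum>s. norm (Y s))" by (rule summable_norm[OF sn])
    also have "\<dots> \<le> sqrt f * norm \<xi>" by (rule suminf_le_const[OF sn partial])
    finally show "onorm (blinfun_apply (suminf Y)) \<le> sqrt f * norm \<xi>"
      by (simp add: norm_blinfun.rep_eq)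
    have "blinfun_apply (Y s) = (\<lambda>\<eta>. c s *\<^sub>R \<pi> (component s \<xi>) \<eta>)" for s
      by (simp add: fun_eq_iff Y_apply)
    then show "blinfun_apply (suminf Y) \<in> Linf G \<pi>"
      by (intro Linf_suminf sY) (simp add: Linf_scaleR \<pi>_Linf component_Pol)
  qed
qed

end

theorem theorem2p1:
  fixes G :: "('a::cstar_algebra, 'b::cstar_algebra, 'c::cstar_algebra) quantum_group"
    and h :: "'a \<Rightarrow> complex"
    and \<Lambda> :: "'a \<Rightarrow> 'h::complex_hilbert"
    and \<pi> :: "'a \<Rightarrow> 'h \<Rightarrow> 'h"
    and u :: "nat \<Rightarrow> 'a mat"
    and \<phi> :: "real \<Rightarrow> 'a \<Rightarrow> complex"
    and L :: "'a \<Rightarrow> complex"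
    and T :: "real \<Rightarrow> 'a \<Rightarrow> 'a"
    and T\<^sub>L :: "'a \<Rightarrow> 'a"
    and lam :: "nat \<Rightarrow> real"
    and \<alpha> \<beta> \<gamma> :: real
  assumes "compact_quantum_group G"
    and "haar_state G h"
    and "tracial h"
    and "gns_construction (Pol G) h \<Lambda> \<pi>"
    and "irrep_enumeration G u"
    and "convolution_semigroup G \<phi>"
    and "generating_functional G \<phi> L"
    and "\<And>t. T t = id_tensor G (\<phi> t)"
    and "T\<^sub>L = id_tensor G L"
    and "\<And>s x. x \<in> coeff_space (u s) \<Longrightarrow> T\<^sub>L x = lam s *\<^sub>R x"
    and "\<alpha> > 0"
    and "\<And>s. lam s \<le> - \<alpha> * real s"
    and "\<beta> \<ge> 0" and "\<gamma> \<ge> 0"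
    and "\<And>s x. x \<in> coeff_space (u s) \<Longrightarrow> onorm (\<pi> x) \<le> (\<beta> * real s + \<gamma>) * L2_norm h x"
  shows "ultracontractive G \<Lambda> \<pi> T \<and>
    (\<forall>t>0. \<forall>\<xi>. Linf_norm_le G \<Lambda> \<pi> (L2_extension G \<Lambda> (T t) \<xi>)
       (sqrt ((\<beta>\<^sup>2 * exp (- 2 * \<alpha> * t) * (1 + exp (- 2 * \<alpha> * t))
                + 2 * \<beta> * \<gamma> * exp (- 2 * \<alpha> * t) * (1 - exp (- 2 * \<alpha> * t))
                + \<gamma>\<^sup>2 * (1 - exp (- 2 * \<alpha> * t))\<^sup>2)
              / (1 - exp (- 2 * \<alpha> * t)) ^ 3) * norm \<xi>))"
proof -
  interpret enumerated_gns G h \<Lambda> \<pi> u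
    using assms(1-5) by unfold_locales
  let ?f = "\<lambda>t. (\<beta>\<^sup>2 * exp (- 2 * \<alpha> * t) * (1 + exp (- 2 * \<alpha> * t))
                + 2 * \<beta> * \<gamma> * exp (- 2 * \<alpha> * t) * (1 - exp (- 2 * \<alpha> * t))
                + \<gamma>\<^sup>2 * (1 - exp (- 2 * \<alpha> * t))\<^sup>2)
              / (1 - exp (- 2 * \<alpha> * t)) ^ 3"
  have bound: "Linf_norm_le G \<Lambda> \<pi> (L2_extension G \<Lambda> (T t) \<xi>) (sqrt (?f t) * norm \<xi>)" if t: "t > 0" for t \<xi>
  proof -
    define c where "c s = exp (lam s * t)" for s
    have c_le: "c s \<le> exp (- \<alpha> * t) ^ s" for s
    proof -
      have "lam s * t \<le> real s * (- \<alpha> * t)"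
        using mult_right_mono[OF assms(12)[of s], of t] t by (simp add: mult_ac)
      then show ?thesis by (simp add: c_def exp_of_nat_mult[symmetric])
    qed
    have c_pos: "c s > 0" for s by (simp add: c_def)
    have q: "exp (- \<alpha> * t) < 1" "exp (- 2 * \<alpha> * t) < 1"
      using t assms(11) by simp_all
    \<comment> \<open>The eigenvalue bound \<open>c_le\<close> gives a geometric majorant with ratio
      \<open>exp (- \<alpha> * t) < 1\<close>.\<close>
    have c: "summable (\<lambda>s. \<bar>c s\<bar>)"
    proof (rule summable_comparison_test'[of _ 0])
      show "summable (\<lambda>s. exp (- \<alpha> * t) ^ s)"
        using q(1) by (intro summable_geometric) simp
    qed (use c_le c_pos in \<open>auto simp: less_imp_le\<close>)
    have \<phi>lin: "clinear_on (Pol G) (\<phi> t)"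
      using assms(6) t by (simp add: convolution_semigroup_def state_on_def)
    have "exp (complex_of_real (lam s * t)) = of_real (c s)" for s
      by (simp only: c_def exp_of_real)
    then have "T t (u s $$ (i, j)) = c s *\<^sub>R u s $$ (i, j)" if "i < deg s" "j < deg s" for s i j
      using markov_semigroup_coeff[OF assms(1,6,7) irr t, of s "lam s" i j] assms(8-10) that
      by (simp add: scaleR_scaleC del: of_real_mult)
    moreover have "clinear_on (Pol G) (T t)"
      unfolding assms(8) by (rule id_tensor_clinear[OF assms(1) \<phi>lin])
    ultimately have ext: "L2_extension G \<Lambda> (T t) = (\<lambda>\<xi>. \<Sum>s. c s *\<^sub>R proj s \<xi>)"
      using L2_extension_eq[OF c] by blast
    have "(\<Sum>s<N. (c s * (\<beta> * real s + \<gamma>))\<^sup>2) \<le> ?f t" for N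
    proof -
      have "(\<Sum>s<N. (c s * (\<beta> * real s + \<gamma>))\<^sup>2) \<le> (\<Sum>s<N. exp (- 2 * \<alpha> * t) ^ s * (\<beta> * real s + \<gamma>)\<^sup>2)"
      proof (rule sum_mono)
        fix s
        \<comment> \<open>Squaring the eigenvalue bound doubles the rate, which is the origin of the
          parameter \<open>exp (- 2 * \<alpha> * t)\<close> in the final bound.\<close>
        have "(c s)\<^sup>2 \<le> (exp (- \<alpha> * t) ^ s)\<^sup>2"
          using c_le c_pos by (intro power_mono) (auto simp: less_imp_le)
        also have "\<dots> = exp (- 2 * \<alpha> * t) ^ s"
          by (simp add: power2_eq_square mult.assoc flip: power_mult_distrib exp_add)
        finally show "(c s * (\<beta> * real s + \<gamma>))\<^sup>2 \<le> exp (- 2 * \<alpha> * t) ^ s * (\<beta> * real s + \<gamma>)\<^sup>2"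
          by (simp add: power_mult_distrib mult_right_mono)
      qed
      also have "\<dots> \<le> ?f t"
        using q(2) assms(13,14) by (intro weighted_square_sum_le) auto
      finally show ?thesis .
    qed
    from multiplier_Linf_norm_le[OF c assms(15) this]
    show ?thesis unfolding ext .
  qed
  \<comment> \<open>Ultracontractivity follows because the constant \<open>sqrt (?f t)\<close> does
    not depend on \<xi>.\<close>
  then show ?thesis
    unfolding ultracontractive_def by blast
qed

end
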